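(* Let $A\in\mathbb{R}^{d\times n}$ have full row rank, $b\in\mathbb{R}^d$, $c\in\mathbb{R}^n$, and consider the linear program $\min\{c^\top x: Ax=b,\ x\ge 0\}$. Assume it has inner radius $r>0$, outer radius $R$ and Lipschitz constant $L$ (defined in the context). Then for an accuracy parameter $\delta$, the algorithm $\mathtt{SlowSolveLP}$ (described in the context) outputs $x$ such that \[ c^\top x\le \min_{Ax'=b,\,x'\ge0}c^\top x'+\delta LR,\qquad Ax=b,\qquad x\ge 0, \] and it takes $O(\sqrt n\log(nR/(\delta r)))$ Newton steps. If moreover the minimizer $x^*=\arg\min_{Ax'=b,x'\ge0}c^\top x'$ is unique and $c^\top x\ge c^\top x^*+\eta LR$ for every other vertex $x$ of $\{x: Ax=b,x\ge0\}$, for some $\eta>\delta\ge0$, then the output satisfies $\|x-x^*\|_2\le \frac{2\delta R}{\eta}$.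
   Context: Notation: for vectors $u,v$, $uv$ and $u/v$ are coordinatewise product and quotient; a scalar $t$ used as a vector means $t\mathbf{1}$; for a vector $x$, $X=\mathrm{Diag}(x)$ (similarly $S=\mathrm{Diag}(s)$). Feasible sets: $\mathcal{P}=\{x\in\mathbb{R}^n_{\ge0}:Ax=b\}$, $\mathcal{D}=\{s\in\mathbb{R}^n_{\ge0}: A^\top y+s=c\text{ for some }y\}$, and their interiors $\mathcal{P}^\circ,\mathcal{D}^\circ$ (same sets with strict positivity). LP parameters: inner radius $r$: there exists $x\in\mathcal{P}$ with $x_i\ge r$ for all $i$; outer radius $R$: every $x\ge0$ with $Ax=b$ has $\|x\|_2\le R$; Lipschitz constant $L$: $\|c\|_2\le L$. A Newton step at $(x,s)$ with target $\mu$ computes $(\delta_x,\delta_s,\delta_y)$ solving $S\delta_x+X\delta_s=\mu-xs$, $A\delta_x=0$, $A^\top\delta_y+\delta_s=0$ and moves to $(x+\delta_x,s+\delta_s)$. Procedure $\mathtt{L2Step}(A,x,s,t_{\rm start},t_{\rm end})$ (for a constraint matrix $A$ with $n$ columns): set $t=t_{\rm start}$, $h=1/(16\sqrt n)$, $P_{x,s}=S^{-1}A^\top(AS^{-1}XA^\top)^{-1}AX$. While $t\neq t_{\rm end}$: let $t'=\max(t/(1+h),t_{\rm end})$, $\mu=xs$, $\delta_\mu=t'-\mu$, $\delta_x=X(I-P_{x,s})(\delta_\mu/\mu)$, $\delta_s=SP_{x,s}(\delta_\mu/\mu)$; set $x\leftarrow x+\delta_x$, $s\leftarrow s+\delta_s$,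 $t\leftarrow t'$. Return $(x,s)$. Each iteration is one Newton step. Modified LP with parameters $\overline R,t$: let $x_c^+=t/(c+t/\overline R)$ (coordinatewise), $x_c^-=x_c^+-A^\top(AA^\top)^{-1}b$, $\widetilde c=t/x_c^-$, $\widetilde b=\sum_i x^+_{c,i}+\overline R$. The modified LP is $\min\{c^\top x^++\widetilde c^\top x^-: (x^+,x^-,x^\theta)\in\mathbb{R}^{2n+1}_{\ge0},\ A(x^+-x^-)=b,\ \sum_i x_i^++x^\theta=\widetilde b\}$, i.e. $\min\{\overline c^\top \overline x:\overline A\,\overline x=\overline b,\overline x\ge0\}$ with $\overline A=\begin{pmatrix}A&-A&0\\ \mathbf 1^\top&0&1\end{pmatrix}$, $\overline c=(c,\widetilde c,0)$, $\overline b=(b,\widetilde b)$. Algorithm $\mathtt{SlowSolveLP}(A,b,c,\delta)$: let $\epsilon=1/(100\sqrt n)$, $\overline R=5R/\epsilon$, $t=2^{16}\epsilon^{-3}n^2\frac{R}{r}LR$; form the modified LP with these parameters; let $\overline x=(x_c^+,x_c^-,\overline R)$ and $\overline s=t/\overline x$; run $(\overline x,\overline s)\leftarrow\mathtt{L2Step}(\overline A,\overline x,\overline s,t,LR)$; writing $\overline x=(x^+,x^-,x^\theta)$, $\overline s=(s^+,s^-,s^\theta)$, run $(x_{\rm end},s_{\rm end})=\mathtt{L2Step}(A,x^+-x^-,s^+-s^\theta\mathbf 1,LR,t_{\rm end})$ with $t_{\rm end}=\delta LR/(2n)$; return $x_{\rm end}$.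
   Formalization: Assumes n ≥ 1, L > 0 and δ ≤ 2n (for larger δ the second L2Step jumps upward and the claim can fail); the first part needs δ > 0, since for δ = 0 the loop never ends; the logarithm's argument is max(2, nR/(δr)), as the literal bound can be 0. *)

theory Defs
  imports
    Complex_Main
    "HOL-Library.While_Combinator"
    "Jordan_Normal_Form.DL_Rank"
    "Jordan_Normal_Form.Gauss_Jordan_Elimination"
begin

text \<open>
  Vectors and matrices are those of Jordan_Normal_Form, whose dimensions are terms: this lets the
  constant hidden in an \<open>O\<close>-bound be quantified before the dimensions.
\<close>

definition full_row_rank :: "real mat \<Rightarrow> bool" where
  "full_row_rank A \<longleftrightarrow> vec_space.rank (dim_row A) A = dim_row A"

definition l2_norm :: "real vec \<Rightarrow> real" where
  "l2_norm v = sqrt (v \<bullet> v)"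

definition const_vec :: "nat \<Rightarrow> real \<Rightarrow> real vec" where
  "const_vec n t = vec n (\<lambda>i. t)"

definition vec_mult :: "real vec \<Rightarrow> real vec \<Rightarrow> real vec" where
  "vec_mult u v = vec (dim_vec u) (\<lambda>i. u $ i * v $ i)"

definition vec_div :: "real vec \<Rightarrow> real vec \<Rightarrow> real vec" where
  "vec_div u v = vec (dim_vec u) (\<lambda>i. u $ i / v $ i)"

definition Diag :: "real vec \<Rightarrow> real mat" where
  "Diag x = mat_diag (dim_vec x) (\<lambda>i. x $ i)"

text \<open>Unspecified if the matrix is not invertible.\<close>

definition inv_mat :: "real mat \<Rightarrow> real mat" where
  "inv_mat A = the (mat_inverse A)"


section \<open>Linear programs\<close>

definition lp_feasible :: "real mat \<Rightarrow> real vec \<Rightarrow> real vec set" where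
  "lp_feasible A b =
    {x \<in> carrier_vec (dim_col A). A *\<^sub>v x = b \<and> 0\<^sub>v (dim_col A) \<le> x}"

definition lp_minimizer :: "real mat \<Rightarrow> real vec \<Rightarrow> real vec \<Rightarrow> real vec \<Rightarrow> bool" where
  "lp_minimizer A b c x \<longleftrightarrow> is_arg_min (\<lambda>x'. c \<bullet> x') (\<lambda>x'. x' \<in> lp_feasible A b) x"

text \<open>
  Vertices are the extreme points; HOL-Analysis' notion needs a \<open>real_vector\<close> type and so does not
  apply to Jordan_Normal_Form vectors.
\<close>

definition lp_vertex :: "real mat \<Rightarrow> real vec \<Rightarrow> real vec \<Rightarrow> bool" where
  "lp_vertex A b x \<longleftrightarrow> x \<in> lp_feasible A b \<and>
    \<not> (\<exists>y \<in> lp_feasible A b. \<exists>z \<in> lp_feasible A b. \<exists>u::real.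
        y \<noteq> z \<and> 0 < u \<and> u < 1 \<and> x = (1 - u) \<cdot>\<^sub>v y + u \<cdot>\<^sub>v z)"

definition inner_radius :: "real mat \<Rightarrow> real vec \<Rightarrow> real \<Rightarrow> bool" where
  "inner_radius A b r \<longleftrightarrow> (\<exists>x \<in> lp_feasible A b. \<forall>i < dim_col A. r \<le> x $ i)"

definition outer_radius :: "real mat \<Rightarrow> real vec \<Rightarrow> real \<Rightarrow> bool" where
  "outer_radius A b R \<longleftrightarrow> (\<forall>x \<in> lp_feasible A b. l2_norm x \<le> R)"


section \<open>The path-following procedure\<close>

definition proj_mat :: "real mat \<Rightarrow> real vec \<Rightarrow> real vec \<Rightarrow> real mat" where
  "proj_mat A x s =
    inv_mat (Diag s) * transpose_mat A *
      inv_mat (A * inv_mat (Diag s) * Diag x * transpose_mat A) * A * Diag x"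

text \<open>
  The closed form of the solution of \<open>S \<delta>x + X \<delta>s = t' - x s\<close>, \<open>A \<delta>x = 0\<close>, \<open>A\<^sup>T \<delta>y + \<delta>s = 0\<close>.
\<close>

definition newton_step :: "real mat \<Rightarrow> real \<Rightarrow> real vec \<Rightarrow> real vec \<Rightarrow> real vec \<times> real vec" where
  "newton_step A t' x s =
    (let n = dim_col A;
         P = proj_mat A x s;
         \<mu> = vec_mult x s;
         \<delta>\<mu> = const_vec n t' - \<mu>;
         \<delta>x = Diag x *\<^sub>v ((1\<^sub>m n - P) *\<^sub>v vec_div \<delta>\<mu> \<mu>);
         \<delta>s = Diag s *\<^sub>v (P *\<^sub>v vec_div \<delta>\<mu> \<mu>)
     in (x + \<delta>x, s + \<delta>s))"

text \<open>
  The result carries the number of loop iterations, each of which is one Newton step; it is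
  \<open>None\<close> if the loop does not terminate.
\<close>

definition l2_step ::
  "real mat \<Rightarrow> real vec \<Rightarrow> real vec \<Rightarrow> real \<Rightarrow> real \<Rightarrow> (real vec \<times> real vec \<times> nat) option" where
  "l2_step A x s t_start t_end =
    (let h = 1 / (16 * sqrt (real (dim_col A)))
     in map_option (\<lambda>(x, s, t, k). (x, s, k))
          (while_option (\<lambda>(x, s, t, k). t \<noteq> t_end)
            (\<lambda>(x, s, t, k).
              let t' = max (t / (1 + h)) t_end;
                  (x', s') = newton_step A t' x s
              in (x', s', t', Suc k))
            (x, s, t_start, 0)))"


section \<open>The modified linear program and the algorithm\<close>

definition xc_plus :: "real vec \<Rightarrow> real \<Rightarrow> real \<Rightarrow> real vec" where
  "xc_plus c Rbar t =
    vec_div (const_vec (dim_vec c) t) (c + const_vec (dim_vec c) (t / Rbar))"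

definition xc_minus :: "real mat \<Rightarrow> real vec \<Rightarrow> real vec \<Rightarrow> real \<Rightarrow> real \<Rightarrow> real vec" where
  "xc_minus A b c Rbar t =
    xc_plus c Rbar t - transpose_mat A *\<^sub>v (inv_mat (A * transpose_mat A) *\<^sub>v b)"

text \<open>
  The constraint matrix with block rows \<open>(A, -A, 0)\<close> and \<open>(1, 0, 1)\<close>. The procedure reads nothing
  else of the modified program: its right-hand side and cost vector enter only through the initial
  primal-dual pair.
\<close>

definition modified_mat :: "real mat \<Rightarrow> real mat" where
  "modified_mat A =
    (let d = dim_row A; n = dim_col A
     in mat (d + 1) (2 * n + 1) (\<lambda>(i, j).
          if i < d then
            (if j < n then A $$ (i, j) else if j < 2 * n then - A $$ (i, j - n) else 0)
          else
            (if j < n then 1 else if j < 2 * n then 0 else 1)))"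

definition slow_solve_lp ::
  "real mat \<Rightarrow> real vec \<Rightarrow> real vec \<Rightarrow> real \<Rightarrow> real \<Rightarrow> real \<Rightarrow> real \<Rightarrow> (real vec \<times> nat) option" where
  "slow_solve_lp A b c r R L \<delta> =
    (let n = dim_col A;
         \<epsilon> = 1 / (100 * sqrt (real n));
         Rbar = 5 * R / \<epsilon>;
         t = 2 ^ 16 / \<epsilon> ^ 3 * real n ^ 2 * (R / r) * L * R;
         xbar = xc_plus c Rbar t @\<^sub>v (xc_minus A b c Rbar t @\<^sub>v const_vec 1 Rbar);
         sbar = vec_div (const_vec (2 * n + 1) t) xbar;
         t_end = \<delta> * L * R / (2 * real n)
     in case l2_step (modified_mat A) xbar sbar t (L * R) of
          None \<Rightarrow> None
        | Some (xb, sb, k1) \<Rightarrow>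
            (let x_plus = vec_first xb n;
                 x_minus = vec n (\<lambda>i. xb $ (n + i));
                 s_plus = vec_first sb n;
                 s_theta = sb $ (2 * n)
             in case l2_step A (x_plus - x_minus) (s_plus - const_vec n s_theta) (L * R) t_end of
                  None \<Rightarrow> None
                | Some (x_end, s_end, k2) \<Rightarrow> Some (x_end, k1 + k2)))"

end

theory Submission
  imports Defs "HOL-Analysis.L2_Norm"
begin

text \<open>
  A Newton step towards \<open>t'\<close> splits \<open>t' - x s\<close> into \<open>s \<delta>x + x \<delta>s\<close> with \<open>\<delta>x\<close> orthogonal to \<open>\<delta>s\<close>, and
  the new products miss \<open>t'\<close> by exactly \<open>\<delta>x \<delta>s\<close>. Hence an \<open>\<ell>\<^sub>2\<close> distance of at most \<open>t/8\<close> from the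
  central path shrinks to \<open>t'/32\<close>, which pays for decreasing \<open>t\<close> by the factor \<open>1 + h\<close>.
  The modified program starts exactly on its central path. When its parameter has come down to \<open>L R\<close>,
  comparing the duality gap with a point \<open>x \<ge> r\<close> bounds \<open>x\<^sup>-\<close> from above and \<open>x\<^sup>+\<close> from below, and the
  outer radius bounds \<open>x\<^sup>+\<close> from above; so \<open>x\<^sup>-\<close> and \<open>s\<^sup>\<theta>\<close> are negligible against \<open>x\<^sup>+\<close> and \<open>s\<^sup>+\<close>,
  and \<open>(x\<^sup>+ - x\<^sup>-, s\<^sup>+ - s\<^sup>\<theta>)\<close> lies within \<open>L R / 8\<close> of the central path of the original program.
  The distance bound holds because \<open>\<eta> L \<parallel>x - x\<^sup>*\<parallel> \<le> 2 (c\<^sup>T x - c\<^sup>T x\<^sup>*)\<close> is a convex condition on \<open>x\<close>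
  that is true at every vertex.
\<close>

section \<open>One Newton step, coordinatewise\<close>

text \<open>Two radii are in play. A step turns a relative distance of 1/8 into 1/32, so every
  radius between the two is invariant. The first phase starts at distance 0 and is run with 1/32,
  which leaves room for the error of dropping x^- and s^\<theta>; the second phase needs only 1/8.
  What makes x^- small is its price: \<open>t0 / xm0\<close> is of order q^6 (R/r) L with q = sqrt
  n, while the duality gap at parameter L R and the possible savings in the cost of x^+ are at most
  of order q^3 L R. The estimates have to be bootstrapped, because the outer radius speaks of
  solutions of A x = b, and x^+ alone is none: the budget row bounds x^+ crudely, hence x^- is
  small, hence x^+ - x^- is almost nonnegative and x^+ is at most 2 R; with this the same gap
  inequality is read again for the lower bound on x^+. The existence of an optimum also rests on
  vertices, not on compactness: there are finitely many of them, and a condition preserved by convex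
  combinations need only be checked there.\<close>

lemma sum_add_square_le:
  fixes p q :: "nat \<Rightarrow> real"
  assumes "(\<Sum>i<m. (p i)\<^sup>2) \<le> a" and "(\<Sum>i<m. (q i)\<^sup>2) \<le> b"
  shows "(\<Sum>i<m. (p i + q i)\<^sup>2) \<le> 3 / 2 * a + 3 * b"
proof -
  \<comment> \<open>Young's inequality with weights 1 + \<theta> and 1 + 1/\<theta> at \<theta> =
    1/2. This is sharp for norms in ratio 2 : 1, as in the contraction lemma, where they are t/8 and
    t/16 and the bound is (3t/16)^2.\<close>
  have "(p i + q i)\<^sup>2 \<le> 3 / 2 * (p i)\<^sup>2 + 3 * (q i)\<^sup>2" for i
  proof -
    have "3 / 2 * (p i)\<^sup>2 + 3 * (q i)\<^sup>2 - (p i + q i)\<^sup>2 = (p i - 2 * q i)\<^sup>2 / 2"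
      by (simp add: power2_eq_square field_simps)
    also have "0 \<le> \<dots>" by simp
    finally show ?thesis by simp
  qed
  then have "(\<Sum>i<m. (p i + q i)\<^sup>2) \<le> (\<Sum>i<m. 3 / 2 * (p i)\<^sup>2 + 3 * (q i)\<^sup>2)"
    by (intro sum_mono) auto
  also have "\<dots> = 3 / 2 * (\<Sum>i<m. (p i)\<^sup>2) + 3 * (\<Sum>i<m. (q i)\<^sup>2)"
    by (simp add: sum.distrib sum_distrib_left)
  finally show ?thesis using assms by linarith
qed

lemma sum_mult_le_mult_sum:
  fixes f g :: "'a \<Rightarrow> real"
  assumes "finite I" and "\<And>i. i \<in> I \<Longrightarrow> 0 \<le> f i" and "\<And>i. i \<in> I \<Longrightarrow> 0 \<le> g i"
  shows "(\<Sum>i\<in>I. f i * g i) \<le> (\<Sum>i\<in>I. f i) * (\<Sum>i\<in>I. g i)"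
proof -
  have "(\<Sum>i\<in>I. f i * g i) \<le> (\<Sum>i\<in>I. f i * (\<Sum>j\<in>I. g j))"
    by (intro sum_mono mult_left_mono member_le_sum) (use assms in auto)
  then show ?thesis by (simp add: sum_distrib_right)
qed

text \<open>The weights s/x and x/s make the two halves of the step comparable:
  \<open>\<alpha> i + \<beta> i\<close> is (t' - x s)^2 / (x s) up to a cross term 2 dx ds, which
  \<open>orth\<close> removes after summation. So the energy \<open>U\<close> is at most 9/224 t and
  yields every claim: \<open>\<alpha> i\<close> <= U < x s means |dx| < x, likewise for s, and the
  new error dx ds has the square \<open>\<alpha> i * \<beta> i\<close>.\<close>

lemma newton_contraction:
  fixes x s dx ds :: "nat \<Rightarrow> real"
  assumes m: "0 < m"
    and x: "\<And>i. i < m \<Longrightarrow> 0 < x i" and s: "\<And>i. i < m \<Longrightarrow> 0 < s i"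
    and t: "0 < t" and t'_ge: "t / (1 + 1 / (16 * sqrt (real m))) \<le> t'" and t'_le: "t' \<le> t"
    and close: "(\<Sum>i<m. (x i * s i - t)\<^sup>2) \<le> (t / 8)\<^sup>2"
    and newton: "\<And>i. i < m \<Longrightarrow> s i * dx i + x i * ds i = t' - x i * s i"
    and orth: "(\<Sum>i<m. dx i * ds i) = 0"
  shows "\<And>i. i < m \<Longrightarrow> 0 < x i + dx i" and "\<And>i. i < m \<Longrightarrow> 0 < s i + ds i"
    and "(\<Sum>i<m. ((x i + dx i) * (s i + ds i) - t')\<^sup>2) \<le> (t' / 32)\<^sup>2"
proof -
  define h where "h = 1 / (16 * sqrt (real m))"
  have q: "1 \<le> sqrt (real m)" using m by simp
  have h: "0 < h" "h \<le> 1 / 16"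
    using q m unfolding h_def by (auto simp: field_simps)
  \<comment> \<open>This fixes the size of h: moving the target by at most t h in each of m
    coordinates costs at most t/16 in the 2-norm.\<close>
  have mh: "real m * h\<^sup>2 = 1 / 256"
    using m unfolding h_def by (simp add: power_divide power_mult_distrib)
  have "t * (1 - h) \<le> t / (1 + h)"
    using h t by (simp add: field_simps)
  then have diff: "0 \<le> t - t'" "t - t' \<le> t * h"
    using t'_ge t'_le unfolding h_def[symmetric] by (auto simp: algebra_simps)
  have "t * (16 / 17) \<le> t / (1 + h)"
    using h t by (simp add: field_simps)
  then have t't: "t * (16 / 17) \<le> t'" using t'_ge unfolding h_def by (rule order_trans)
  have prod_ge: "7 / 8 * t \<le> x i * s i" if i: "i < m" for i
  proof -
    have "(x i * s i - t)\<^sup>2 \<le> (\<Sum>i<m. (x i * s i - t)\<^sup>2)"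
      using i by (intro member_le_sum) auto
    then have "(x i * s i - t)\<^sup>2 \<le> (t / 8)\<^sup>2" using close by linarith
    then have "\<bar>x i * s i - t\<bar> \<le> t / 8"
      using t by (metis abs_le_square_iff abs_of_pos divide_pos_pos zero_less_numeral)
    then show ?thesis by linarith
  qed
  have dist: "(\<Sum>i<m. (t' - x i * s i)\<^sup>2) \<le> 9 / 256 * t\<^sup>2"
  proof -
    have "(\<Sum>i<m. (t - t')\<^sup>2) \<le> t\<^sup>2 / 256"
    proof -
      have "(t - t')\<^sup>2 \<le> (t * h)\<^sup>2" using diff by (intro power_mono) auto
      then have "real m * (t - t')\<^sup>2 \<le> real m * (t * h)\<^sup>2" by (intro mult_left_mono) auto
      also have "\<dots> = t\<^sup>2 * (real m * h\<^sup>2)" by (simp add: power_mult_distrib)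
      finally show ?thesis using mh by simp
    qed
    from sum_add_square_le[OF close this]
    have "(\<Sum>i<m. (x i * s i - t + (t - t'))\<^sup>2) \<le> 3 / 2 * (t / 8)\<^sup>2 + 3 * (t\<^sup>2 / 256)" .
    then show ?thesis by (simp add: power_divide power2_commute)
  qed
  define \<alpha> where "\<alpha> i = s i / x i * (dx i)\<^sup>2" for i
  define \<beta> where "\<beta> i = x i / s i * (ds i)\<^sup>2" for i
  have ab: "0 \<le> \<alpha> i" "0 \<le> \<beta> i" if "i < m" for i
    using x[OF that] s[OF that] by (auto simp: \<alpha>_def \<beta>_def)
  define U where "U = (\<Sum>i<m. \<alpha> i) + (\<Sum>i<m. \<beta> i)"
  have "U = (\<Sum>i<m. (t' - x i * s i)\<^sup>2 / (x i * s i))"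
  proof -
    have "\<alpha> i + \<beta> i = (t' - x i * s i)\<^sup>2 / (x i * s i) - 2 * (dx i * ds i)" if "i < m" for i
      unfolding newton[OF that, symmetric] \<alpha>_def \<beta>_def
      using x[OF that] s[OF that] by (simp add: field_simps power2_eq_square)
    then have "U = (\<Sum>i<m. (t' - x i * s i)\<^sup>2 / (x i * s i) - 2 * (dx i * ds i))"
      unfolding U_def sum.distrib[symmetric] by (intro sum.cong) auto
    then show ?thesis
      using orth by (simp add: sum_subtractf sum_distrib_left[symmetric])
  qed
  also have "\<dots> \<le> (\<Sum>i<m. (t' - x i * s i)\<^sup>2 / (7 / 8 * t))"
    using prod_ge t by (intro sum_mono divide_left_mono) (auto intro!: mult_pos_pos x s)
  also have "\<dots> = (\<Sum>i<m. (t' - x i * s i)\<^sup>2) / (7 / 8 * t)"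
    by (simp only: sum_divide_distrib)
  also have "\<dots> \<le> (9 / 256 * t\<^sup>2) / (7 / 8 * t)"
    using t by (intro divide_right_mono dist) auto
  also have "\<dots> = 9 / 224 * t" using t by (simp add: power2_eq_square field_simps)
  finally have U: "U \<le> 9 / 224 * t" .
  have U_ge: "\<alpha> i \<le> U" "\<beta> i \<le> U" if i: "i < m" for i
  proof -
    have "\<alpha> i \<le> (\<Sum>i<m. \<alpha> i)" "\<beta> i \<le> (\<Sum>i<m. \<beta> i)"
      using i ab by (auto intro!: member_le_sum)
    moreover have "0 \<le> (\<Sum>i<m. \<alpha> i)" "0 \<le> (\<Sum>i<m. \<beta> i)" using ab by (auto intro!: sum_nonneg)
    ultimately show "\<alpha> i \<le> U" "\<beta> i \<le> U" unfolding U_def by linarith+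
  qed
  \<comment> \<open>Abstract u and v, because it is used twice with the roles of x and s
    exchanged.\<close>
  have bound: "\<bar>w\<bar> < u" if "0 < u" "0 < v" "v / u * w\<^sup>2 \<le> U" "7 / 8 * t \<le> u * v" for u v w :: real
  proof -
    have "v / u * w\<^sup>2 < u * v" using that U t by linarith
    then have "v * w\<^sup>2 < v * u\<^sup>2" using that by (simp add: field_simps power2_eq_square)
    then have "w\<^sup>2 < u\<^sup>2" using that by simp
    then have "\<bar>w\<bar>\<^sup>2 < u\<^sup>2" by simp
    then show ?thesis using that by (intro power2_less_imp_less[of "\<bar>w\<bar>" u]) auto
  qed
  show "0 < x i + dx i" if "i < m" for i
    using bound[OF x[OF that] s[OF that] _ prod_ge[OF that]] U_ge[OF that] unfolding \<alpha>_def by fastforce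
  show "0 < s i + ds i" if "i < m" for i
    using bound[OF s[OF that] x[OF that], of "ds i"] prod_ge[OF that] U_ge[OF that]
    unfolding \<beta>_def by (simp add: mult.commute)
  have "(\<Sum>i<m. ((x i + dx i) * (s i + ds i) - t')\<^sup>2) = (\<Sum>i<m. \<alpha> i * \<beta> i)"
  proof (intro sum.cong refl)
    fix i assume "i \<in> {..<m}"
    then have i: "i < m" by simp
    have "(x i + dx i) * (s i + ds i) - t' = dx i * ds i"
      using newton[OF i] by (simp add: algebra_simps)
    then show "((x i + dx i) * (s i + ds i) - t')\<^sup>2 = \<alpha> i * \<beta> i"
      using x[OF i] s[OF i] by (simp add: \<alpha>_def \<beta>_def power_mult_distrib)
  qed
  also have "\<dots> \<le> (\<Sum>i<m. \<alpha> i) * (\<Sum>i<m. \<beta> i)"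
    by (rule sum_mult_le_mult_sum) (use ab in auto)
  \<comment> \<open>Arithmetic-geometric mean. Then U/2 <= 9/448 t and t <= 17/16 t' leave less than
    t'/32.\<close>
  also have "\<dots> \<le> (U / 2)\<^sup>2"
    using zero_le_power2[of "(\<Sum>i<m. \<alpha> i) - (\<Sum>i<m. \<beta> i)"]
    unfolding U_def by (simp add: power2_eq_square field_simps)
  also have "\<dots> \<le> (t' / 32)\<^sup>2"
  proof (intro power_mono)
    show "U / 2 \<le> t' / 32" using U t't t by linarith
    show "0 \<le> U / 2" unfolding U_def using ab by (auto intro!: add_nonneg_nonneg sum_nonneg)
  qed
  finally show "(\<Sum>i<m. ((x i + dx i) * (s i + ds i) - t')\<^sup>2) \<le> (t' / 32)\<^sup>2" .
qed

section \<open>The Newton system\<close>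

lemma scalar_prod_lessThan:
  assumes "w \<in> carrier_vec n"
  shows "v \<bullet> w = (\<Sum>i<n. v $ i * w $ i)"
  using assms by (simp add: scalar_prod_def atLeast0LessThan)

lemma scalar_prod_self_eq_0:
  fixes v :: "real vec"
  assumes "v \<in> carrier_vec n" and "v \<bullet> v = 0"
  shows "v = 0\<^sub>v n"
proof (rule eq_vecI)
  fix i assume "i < dim_vec (0\<^sub>v n :: real vec)"
  then have "i \<in> {..<n}" by simp
  moreover have "(\<Sum>i<n. v $ i * v $ i) = 0" using assms by (simp add: scalar_prod_lessThan)
  ultimately have "v $ i * v $ i = 0" by (subst (asm) sum_nonneg_eq_0_iff) auto
  with \<open>i \<in> {..<n}\<close> show "v $ i = 0\<^sub>v n $ i" by simp
qed (use assms in auto)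

text \<open>Linear independence of the rows, put as a trivial kernel of the transpose: this is what
  invertibility of a Gram matrix uses, and it passes to the block matrix without computing a
  rank.\<close>

definition indep_rows :: "real mat \<Rightarrow> bool" where
  "indep_rows A \<longleftrightarrow>
    (\<forall>v \<in> carrier_vec (dim_row A). transpose_mat A *\<^sub>v v = 0\<^sub>v (dim_col A) \<longrightarrow> v = 0\<^sub>v (dim_row A))"

text \<open>Rank d provides d independent columns, which span the whole space. A vector killed by
  the transpose is orthogonal to all columns, hence to their span, hence to itself.\<close>

lemma full_row_rank_imp_indep_rows:
  assumes A: "A \<in> carrier_mat d n" and rank: "full_row_rank A"
  shows "indep_rows A"
  unfolding indep_rows_def
proof (intro ballI impI)
  fix v assume "v \<in> carrier_vec (dim_row A)" and "transpose_mat A *\<^sub>v v = 0\<^sub>v (dim_col A)"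
  then have v: "v \<in> carrier_vec d" and Av: "transpose_mat A *\<^sub>v v = 0\<^sub>v n" using A by auto
  interpret vec_space "TYPE(real)" d .
  have "rank A = d" using A rank by (simp add: full_row_rank_def)
  have cols: "set (cols A) \<subseteq> carrier_vec d" using cols_dim A by blast
  obtain S where S: "finite S" "maximal S (\<lambda>T. T \<subseteq> set (cols A) \<and> lin_indpt T)"
    using maximal_exists_superset[of "set (cols A)" "\<lambda>T. T \<subseteq> set (cols A) \<and> lin_indpt T" "{}"]
    by (auto simp: lin_dep_def)
  have sub: "S \<subseteq> set (cols A)" "lin_indpt S" using S(2) by (auto simp: maximal_def)
  have "card S = d" using rank_card_indpt[OF A S(2)] \<open>rank A = d\<close> by simp
  then have "basis S"
    using S sub cols by (intro dim_li_is_basis) (auto simp: dim_is_n)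
  then have span: "span S = carrier_vec d" by (simp add: basis_def)
  have "v \<bullet> c = 0" if "c \<in> set (cols A)" for c
  proof -
    from that obtain j where j: "j < n" "c = col A j" using A by (auto simp: cols_def)
    have "v \<bullet> c = c \<bullet> v" using v that cols by (intro comm_scalar_prod) auto
    also have "\<dots> = (transpose_mat A *\<^sub>v v) $ j" using j A by simp
    finally show ?thesis using Av j by simp
  qed
  then have "v \<in> orthogonal_complement S" using v sub by (auto simp: orthogonal_complement_def)
  also have "\<dots> = orthogonal_complement (span S)"
    using sub cols by (intro in_orthogonal_complement_span[symmetric]) auto
  finally have "v \<bullet> v = 0" using v by (auto simp: orthogonal_complement_def span)
  then show "v = 0\<^sub>v (dim_row A)" using scalar_prod_self_eq_0[OF v] A by simp
qed

text \<open>\<open>inv_mat\<close> means something only for invertible arguments. All inverses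
  below, of diagonal and of Gram matrices, are reached through this lemma, and only as right
  inverses acting on vectors.\<close>

lemma inv_mat_of_trivial_kernel:
  assumes A: "A \<in> carrier_mat n n"
    and ker: "\<And>v. v \<in> carrier_vec n \<Longrightarrow> A *\<^sub>v v = 0\<^sub>v n \<Longrightarrow> v = 0\<^sub>v n"
  shows "inv_mat A \<in> carrier_mat n n"
    and "w \<in> carrier_vec n \<Longrightarrow> A *\<^sub>v (inv_mat A *\<^sub>v w) = w"
proof -
  have "det A \<noteq> 0" using det_0_iff_vec_prod_zero[OF A] ker by blast
  then have "A \<in> Units (ring_mat TYPE(real) n ())" by (rule det_non_zero_imp_unit[OF A])
  then obtain B where "mat_inverse A = Some B" using mat_inverse(1)[OF A] by fastforce
  then have B: "A * B = 1\<^sub>m n" "B \<in> carrier_mat n n" "inv_mat A = B"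
    using mat_inverse(2)[OF A] by (auto simp: inv_mat_def)
  then show "inv_mat A \<in> carrier_mat n n" by simp
  show "A *\<^sub>v (inv_mat A *\<^sub>v w) = w" if "w \<in> carrier_vec n"
    using B that by (simp add: assoc_mult_mat_vec[OF A, symmetric])
qed

lemma Diag_carrier [simp]: "x \<in> carrier_vec n \<Longrightarrow> Diag x \<in> carrier_mat n n"
  by (auto simp: Diag_def)

lemma Diag_mult_vec:
  assumes "x \<in> carrier_vec n" and "v \<in> carrier_vec n"
  shows "Diag x *\<^sub>v v = vec n (\<lambda>i. x $ i * v $ i)"
proof (rule eq_vecI)
  fix i assume "i < dim_vec (vec n (\<lambda>i. x $ i * v $ i))"
  then have i: "i < n" by simp
  have "(Diag x *\<^sub>v v) $ i = (\<Sum>j<n. (if i = j then x $ j else 0) * v $ j)"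
    using assms i by (simp add: Diag_def mat_diag_def scalar_prod_lessThan)
  also have "\<dots> = (\<Sum>j<n. if i = j then x $ j * v $ j else 0)" by (intro sum.cong) auto
  finally show "(Diag x *\<^sub>v v) $ i = vec n (\<lambda>i. x $ i * v $ i) $ i" using i by simp
qed (use assms in \<open>auto simp: Diag_def mat_diag_def\<close>)

lemma inv_mat_Diag:
  assumes s: "s \<in> carrier_vec n" and pos: "\<And>i. i < n \<Longrightarrow> 0 < s $ i"
  shows "inv_mat (Diag s) \<in> carrier_mat n n"
    and "w \<in> carrier_vec n \<Longrightarrow> inv_mat (Diag s) *\<^sub>v w = vec n (\<lambda>i. w $ i / s $ i)"
proof -
  have ker: "v = 0\<^sub>v n" if v: "v \<in> carrier_vec n" and 0: "Diag s *\<^sub>v v = 0\<^sub>v n" for v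
  proof (rule eq_vecI)
    fix i assume "i < dim_vec (0\<^sub>v n :: real vec)"
    then have i: "i < n" by simp
    have "s $ i * v $ i = (Diag s *\<^sub>v v) $ i" using Diag_mult_vec[OF s v] i by simp
    then show "v $ i = 0\<^sub>v n $ i" using 0 pos[OF i] i by simp
  qed (use v in simp)
  note inv = inv_mat_of_trivial_kernel[OF Diag_carrier[OF s] ker]
  then show D: "inv_mat (Diag s) \<in> carrier_mat n n" by blast
  show "inv_mat (Diag s) *\<^sub>v w = vec n (\<lambda>i. w $ i / s $ i)" if w: "w \<in> carrier_vec n"
  proof (rule eq_vecI)
    fix i assume "i < dim_vec (vec n (\<lambda>i. w $ i / s $ i))"
    then have i: "i < n" by simp
    have "inv_mat (Diag s) *\<^sub>v w \<in> carrier_vec n" using D w by simp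
    then have "s $ i * (inv_mat (Diag s) *\<^sub>v w) $ i = (Diag s *\<^sub>v (inv_mat (Diag s) *\<^sub>v w)) $ i"
      using Diag_mult_vec[OF s] i by simp
    also have "\<dots> = w $ i" using inv(2) w by simp
    finally show "(inv_mat (Diag s) *\<^sub>v w) $ i = vec n (\<lambda>i. w $ i / s $ i) $ i"
      using pos[OF i] i by (simp add: field_simps)
  qed (use D in auto)
qed

text \<open>Pairing the hypothesis with v gives a vanishing sum of the weighted squares of A^T v.
  The weights x/s serve the Newton system, the weights 1 serve A A^T.\<close>

lemma weighted_gram_trivial_kernel:
  assumes A: "A \<in> carrier_mat d n" and indep: "indep_rows A"
    and pos: "\<And>i. i < n \<Longrightarrow> 0 < w i"
    and v: "v \<in> carrier_vec d"
    and 0: "A *\<^sub>v vec n (\<lambda>i. w i * (transpose_mat A *\<^sub>v v) $ i) = 0\<^sub>v d"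
  shows "v = 0\<^sub>v d"
proof -
  define u where "u = transpose_mat A *\<^sub>v v"
  have u: "u \<in> carrier_vec n" using A v by (simp add: u_def)
  have "(\<Sum>i<n. w i * (u $ i)\<^sup>2) = u \<bullet> vec n (\<lambda>i. w i * u $ i)"
    by (simp add: scalar_prod_lessThan[of _ n] power2_eq_square mult_ac)
  also have "\<dots> = v \<bullet> (A *\<^sub>v vec n (\<lambda>i. w i * u $ i))"
    unfolding u_def by (rule transpose_vec_mult_scalar[OF A _ v]) simp
  also have "\<dots> = 0" using 0 v by (simp add: u_def)
  finally have sum: "(\<Sum>i<n. w i * (u $ i)\<^sup>2) = 0" .
  have "u = 0\<^sub>v n"
  proof (rule eq_vecI)
    fix i assume "i < dim_vec (0\<^sub>v n :: real vec)"
    then have i: "i < n" by simp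
    have "w i * (u $ i)\<^sup>2 = 0"
      using pos i by (intro sum_nonneg_0[OF _ _ sum]) (auto simp: less_imp_le)
    then show "u $ i = 0\<^sub>v n $ i" using pos[OF i] i by simp
  qed (use u in simp)
  then show ?thesis using indep v A by (auto simp: indep_rows_def u_def)
qed

text \<open>This is all that is used of the closed form later on; the projection matrix does not
  appear again. The vector w is -\<delta>y.\<close>

lemma newton_step_spec:
  assumes A: "A \<in> carrier_mat d n" and indep: "indep_rows A"
    and x: "x \<in> carrier_vec n" and s: "s \<in> carrier_vec n"
    and xpos: "\<And>i. i < n \<Longrightarrow> 0 < x $ i" and spos: "\<And>i. i < n \<Longrightarrow> 0 < s $ i"
  obtains dx w where "dx \<in> carrier_vec n" and "w \<in> carrier_vec d"
    and "newton_step A t' x s = (x + dx, s + transpose_mat A *\<^sub>v w)"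
    and "A *\<^sub>v dx = 0\<^sub>v d"
    and "\<And>i. i < n \<Longrightarrow> s $ i * dx $ i + x $ i * (transpose_mat A *\<^sub>v w) $ i = t' - x $ i * s $ i"
proof -
  define D where "D = inv_mat (Diag s)"
  define X where "X = Diag x"
  define M where "M = A * D * X * transpose_mat A"
  define v where "v = vec_div (const_vec n t' - vec_mult x s) (vec_mult x s)"
  \<comment> \<open>Since M w = A X v, the projection of v is D A^T w. Hence \<delta>s = A^T w, and
    A dx = A X v - M w vanishes.\<close>
  define w where "w = inv_mat M *\<^sub>v (A *\<^sub>v (X *\<^sub>v v))"
  define u where "u = transpose_mat A *\<^sub>v w"
  define dx where "dx = X *\<^sub>v (v - D *\<^sub>v u)"
  have D: "D \<in> carrier_mat n n" and Dv: "\<And>z. z \<in> carrier_vec n \<Longrightarrow> D *\<^sub>v z = vec n (\<lambda>i. z $ i / s $ i)"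
    unfolding D_def using inv_mat_Diag[OF s spos] by auto
  have X: "X \<in> carrier_mat n n" using x by (simp add: X_def)
  have Xv: "X *\<^sub>v z = vec n (\<lambda>i. x $ i * z $ i)" if "z \<in> carrier_vec n" for z
    unfolding X_def using Diag_mult_vec[OF x that] .
  have At: "transpose_mat A \<in> carrier_mat n d" using A by simp
  have AD: "A * D \<in> carrier_mat d n" and ADX: "A * D * X \<in> carrier_mat d n" using A D X by auto
  have M: "M \<in> carrier_mat d d" unfolding M_def using A D X by auto
  have v: "v \<in> carrier_vec n" using x unfolding v_def vec_div_def const_vec_def vec_mult_def carrier_vec_def by simp
  have vi: "v $ i = (t' - x $ i * s $ i) / (x $ i * s $ i)" if "i < n" for i
    using that x by (simp add: v_def vec_div_def const_vec_def vec_mult_def)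
  have Mz: "M *\<^sub>v z = A *\<^sub>v vec n (\<lambda>i. x $ i / s $ i * (transpose_mat A *\<^sub>v z) $ i)"
    if z: "z \<in> carrier_vec d" for z
  proof -
    have z': "transpose_mat A *\<^sub>v z \<in> carrier_vec n" using At z by simp
    have "M *\<^sub>v z = A *\<^sub>v (D *\<^sub>v (X *\<^sub>v (transpose_mat A *\<^sub>v z)))"
      unfolding M_def
      using assoc_mult_mat_vec[OF ADX At z] assoc_mult_mat_vec[OF AD X z']
        assoc_mult_mat_vec[OF A D, of "X *\<^sub>v (transpose_mat A *\<^sub>v z)"] X z' by simp
    also have "D *\<^sub>v (X *\<^sub>v (transpose_mat A *\<^sub>v z)) = vec n (\<lambda>i. x $ i / s $ i * (transpose_mat A *\<^sub>v z) $ i)"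
      unfolding Xv[OF z'] by (subst Dv) (auto intro!: eq_vecI)
    finally show ?thesis .
  qed
  have ker: "z = 0\<^sub>v d" if "z \<in> carrier_vec d" "M *\<^sub>v z = 0\<^sub>v d" for z
    using weighted_gram_trivial_kernel[OF A indep, of "\<lambda>i. x $ i / s $ i" z] that Mz xpos spos by simp
  note Minv = inv_mat_of_trivial_kernel[OF M ker]
  have Minv_carrier: "inv_mat M \<in> carrier_mat d d" using Minv(1) by blast
  have w: "w \<in> carrier_vec d" and u: "u \<in> carrier_vec n" 
    using Minv_carrier A At X v by (auto simp: w_def u_def)
  have Mw: "M *\<^sub>v w = A *\<^sub>v (X *\<^sub>v v)" unfolding w_def using A X v by (intro Minv(2)) auto
  have P: "proj_mat A x s *\<^sub>v v = D *\<^sub>v u"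
  proof -
    have "proj_mat A x s = D * transpose_mat A * inv_mat M * A * X"
      by (simp add: proj_mat_def D_def X_def M_def)
    moreover have 1: "D * transpose_mat A \<in> carrier_mat n d" using D At by simp
    moreover have 2: "D * transpose_mat A * inv_mat M \<in> carrier_mat n d" using 1 Minv_carrier by simp
    moreover have 3: "D * transpose_mat A * inv_mat M * A \<in> carrier_mat n n" using 2 A by simp
    moreover have "X *\<^sub>v v \<in> carrier_vec n" "A *\<^sub>v (X *\<^sub>v v) \<in> carrier_vec d" using X v A by auto
    ultimately show ?thesis
      using assoc_mult_mat_vec[OF 3 X v] assoc_mult_mat_vec[OF 2 A, of "X *\<^sub>v v"]
        assoc_mult_mat_vec[OF 1 Minv_carrier, of "A *\<^sub>v (X *\<^sub>v v)"]
        assoc_mult_mat_vec[OF D At w] by (simp add: u_def w_def)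
  qed
  have Pc: "proj_mat A x s \<in> carrier_mat n n"
    using D At Minv_carrier A X unfolding proj_mat_def D_def X_def M_def by (intro mult_carrier_mat) auto
  have Du: "D *\<^sub>v u \<in> carrier_vec n" using D u by simp
  have step_x: "(1\<^sub>m n - proj_mat A x s) *\<^sub>v v = v - D *\<^sub>v u"
    using minus_mult_distrib_mat_vec[OF one_carrier_mat Pc v] v P by simp
  have step_s: "Diag s *\<^sub>v (D *\<^sub>v u) = u"
    unfolding Diag_mult_vec[OF s Du] using u by (intro eq_vecI) (auto simp: Dv dest: spos)
  have dx: "dx \<in> carrier_vec n" using X v Du by (simp add: dx_def)
  have dxi: "dx $ i = x $ i * (v $ i - u $ i / s $ i)" if "i < n" for i
    using that u v D by (simp add: dx_def Xv Dv)
  show thesis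
  proof (rule that[OF dx w])
    show "newton_step A t' x s = (x + dx, s + transpose_mat A *\<^sub>v w)"
      using A step_x step_s P
      by (simp add: newton_step_def Let_def v_def[symmetric] dx_def X_def u_def)
    have "dx = X *\<^sub>v v - vec n (\<lambda>i. x $ i / s $ i * u $ i)"
      using dx dxi v by (intro eq_vecI) (auto simp: Xv algebra_simps)
    then have "A *\<^sub>v dx = A *\<^sub>v (X *\<^sub>v v) - M *\<^sub>v w"
      using mult_minus_distrib_mat_vec[OF A, of "X *\<^sub>v v" "vec n (\<lambda>i. x $ i / s $ i * u $ i)"] X v
      by (simp add: Mz[OF w] u_def)
    also have "\<dots> = 0\<^sub>v d" unfolding Mw using A by (intro eq_vecI) auto
    finally show "A *\<^sub>v dx = 0\<^sub>v d" .
    fix i assume i: "i < n"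
    show "s $ i * dx $ i + x $ i * (transpose_mat A *\<^sub>v w) $ i = t' - x $ i * s $ i"
      unfolding u_def[symmetric] dxi[OF i] vi[OF i]
      using xpos[OF i] spos[OF i] by (simp add: field_simps)
  qed
qed

section \<open>Path following\<close>

text \<open>Strict primal and dual feasibility bundled with the relative distance to the path. The
  radius \<open>\<gamma>\<close> is a parameter because the two phases keep different ones.\<close>

definition near_central ::
  "real mat \<Rightarrow> real vec \<Rightarrow> real vec \<Rightarrow> real \<Rightarrow> real \<Rightarrow> real vec \<Rightarrow> real vec \<Rightarrow> bool" where
  "near_central A b c \<gamma> t x s \<longleftrightarrow>
    x \<in> carrier_vec (dim_col A) \<and> s \<in> carrier_vec (dim_col A) \<and> A *\<^sub>v x = b \<and>
    (\<exists>y \<in> carrier_vec (dim_row A). transpose_mat A *\<^sub>v y + s = c) \<and>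
    (\<forall>i < dim_col A. 0 < x $ i \<and> 0 < s $ i) \<and>
    (\<Sum>i<dim_col A. (x $ i * s $ i - t)\<^sup>2) \<le> (\<gamma> * t)\<^sup>2"

lemma near_central_mono:
  assumes "near_central A b c \<gamma> t x s" and "0 \<le> \<gamma>" and "\<gamma> \<le> \<gamma>'" and "0 \<le> t"
  shows "near_central A b c \<gamma>' t x s"
proof -
  have "(\<gamma> * t)\<^sup>2 \<le> (\<gamma>' * t)\<^sup>2"
    using assms by (intro power_mono mult_right_mono) auto
  then show ?thesis using assms(1) by (auto simp: near_central_def)
qed

lemma near_central_newton_step:
  assumes A: "A \<in> carrier_mat d n" and n: "0 < n" and indep: "indep_rows A"
    and near: "near_central A b c (1 / 8) t x s"
    and t: "0 < t" "t / (1 + 1 / (16 * sqrt (real n))) \<le> t'" "t' \<le> t"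
    and step: "newton_step A t' x s = (x', s')"
  shows "near_central A b c (1 / 32) t' x' s'"
proof -
  have dims: "dim_row A = d" "dim_col A = n" using A by auto
  from near have x: "x \<in> carrier_vec n" and s: "s \<in> carrier_vec n" and b: "A *\<^sub>v x = b"
    and pos: "\<And>i. i < n \<Longrightarrow> 0 < x $ i" "\<And>i. i < n \<Longrightarrow> 0 < s $ i"
    and close: "(\<Sum>i<n. (x $ i * s $ i - t)\<^sup>2) \<le> (t / 8)\<^sup>2"
    unfolding near_central_def dims by auto
  from near obtain y where y: "y \<in> carrier_vec d" "transpose_mat A *\<^sub>v y + s = c"
    unfolding near_central_def dims by auto
  obtain dx w where dx: "dx \<in> carrier_vec n" and w: "w \<in> carrier_vec d"
    and eq: "newton_step A t' x s = (x + dx, s + transpose_mat A *\<^sub>v w)"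
    and ker: "A *\<^sub>v dx = 0\<^sub>v d"
    and newton: "\<And>i. i < n \<Longrightarrow>
      s $ i * dx $ i + x $ i * (transpose_mat A *\<^sub>v w) $ i = t' - x $ i * s $ i"
    using newton_step_spec[OF A indep x s pos] by blast
  have x': "x' = x + dx" and s': "s' = s + transpose_mat A *\<^sub>v w" using step eq by auto
  define u where "u = transpose_mat A *\<^sub>v w"
  have u: "u \<in> carrier_vec n" using A w by (simp add: u_def)
  have "(\<Sum>i<n. dx $ i * u $ i) = u \<bullet> dx"
    using dx by (simp add: scalar_prod_lessThan mult.commute)
  also have "\<dots> = w \<bullet> (A *\<^sub>v dx)"
    unfolding u_def by (rule transpose_vec_mult_scalar[OF A dx w])
  also have "\<dots> = 0" using ker w by simp
  finally have orth: "(\<Sum>i<n. dx $ i * u $ i) = 0" .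
  note newton' = newton[folded u_def]
  have contr:
    "\<And>i. i < n \<Longrightarrow> 0 < x $ i + dx $ i" "\<And>i. i < n \<Longrightarrow> 0 < s $ i + u $ i"
    "(\<Sum>i<n. ((x $ i + dx $ i) * (s $ i + u $ i) - t')\<^sup>2) \<le> (t' / 32)\<^sup>2"
    using newton_contraction[of n "\<lambda>i. x $ i" "\<lambda>i. s $ i" t t' "\<lambda>i. dx $ i" "\<lambda>i. u $ i"]
      n pos t close newton' orth by blast+
  have "A *\<^sub>v x' = b"
    unfolding x' using mult_add_distrib_mat_vec[OF A x dx] ker b A x by auto
  moreover have "transpose_mat A *\<^sub>v (y - w) + s' = c"
    unfolding s' y(2)[symmetric]
    using mult_minus_distrib_mat_vec[of "transpose_mat A" n d y w] A y w s
    by (intro eq_vecI) auto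
  moreover have "(\<Sum>i<n. (x' $ i * s' $ i - t')\<^sup>2) \<le> (1 / 32 * t')\<^sup>2"
  proof -
    have "(\<Sum>i<n. (x' $ i * s' $ i - t')\<^sup>2) = (\<Sum>i<n. ((x $ i + dx $ i) * (s $ i + u $ i) - t')\<^sup>2)"
      using dx u s x unfolding x' s' u_def[symmetric] by (intro sum.cong) auto
    then show ?thesis using contr(3) by simp
  qed
  moreover have "x' \<in> carrier_vec n" "s' \<in> carrier_vec n"
    using x dx s u by (auto simp: x' s' u_def)
  moreover have "0 < x' $ i" "0 < s' $ i" if "i < n" for i
    using contr(1,2)[OF that] that x dx s u unfolding x' s' u_def[symmetric] by auto
  moreover have "y - w \<in> carrier_vec d" using y w by simp
  ultimately show ?thesis unfolding near_central_def dims by blast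
qed

definition l2_body ::
  "real mat \<Rightarrow> real \<Rightarrow> real vec \<times> real vec \<times> real \<times> nat \<Rightarrow> real vec \<times> real vec \<times> real \<times> nat" where
  "l2_body A e = (\<lambda>(x, s, t, k).
    let t' = max (t / (1 + 1 / (16 * sqrt (real (dim_col A))))) e;
        (x', s') = newton_step A t' x s
    in (x', s', t', Suc k))"

lemma l2_step_alt:
  "l2_step A x s t e = map_option (\<lambda>(x, s, t, k). (x, s, k))
    (while_option (\<lambda>(x, s, t, k). t \<noteq> e) (l2_body A e) (x, s, t, 0))"
  by (simp add: l2_step_def l2_body_def Let_def)

text \<open>Truncating at \<open>e\<close> in every round amounts to truncating once at the end,
  because e / (1 + h) <= e. The target e = 0 is included for the sake of nontermination.\<close>

lemma l2_body_funpow: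
  assumes e: "0 \<le> e" "e \<le> t" and n: "dim_col A = n" "0 < n"
  shows "\<exists>x' s'. (l2_body A e ^^ k) (x, s, t, 0) =
    (x', s', max (t / (1 + 1 / (16 * sqrt (real n))) ^ k) e, k)"
proof (induction k)
  case 0
  then show ?case using e by (auto simp: max_def)
next
  case (Suc k)
  define h where "h = 1 / (16 * sqrt (real n))"
  have h: "0 < h" using n by (simp add: h_def)
  have "e / (1 + h) \<le> e" using e h by (simp add: field_simps)
  then have "max (max (t / (1 + h) ^ k) e / (1 + h)) e = max (t / (1 + h) ^ k / (1 + h)) e"
  proof (cases "t / (1 + h) ^ k \<le> e")
    case True
    then have "t / (1 + h) ^ k / (1 + h) \<le> e / (1 + h)" using h by (intro divide_right_mono) auto
    then show ?thesis using \<open>e / (1 + h) \<le> e\<close> True by (simp only: max_def) auto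
  qed (simp add: max_def)
  then have "max (max (t / (1 + h) ^ k) e / (1 + h)) e = max (t / (1 + h) ^ Suc k) e"
    by (simp add: mult.commute)
  with Suc show ?case
    by (auto simp: l2_body_def Let_def n h_def split: prod.split)
qed

text \<open>The parameter after k rounds is t / (1 + h)^k, which is positive, so the loop condition
  never fails.\<close>

lemma l2_step_zero_target:
  assumes "0 < t" and "0 < dim_col A"
  shows "l2_step A x s t 0 = None"
proof -
  have "case (l2_body A 0 ^^ k) (x, s, t, 0) of (x, s, t, k) \<Rightarrow> t \<noteq> 0" for k
  proof -
    define \<tau> where "\<tau> = t / (1 + 1 / (16 * sqrt (real (dim_col A)))) ^ k"
    obtain x' s' where "(l2_body A 0 ^^ k) (x, s, t, 0) = (x', s', max \<tau> 0, k)"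
      using l2_body_funpow[of 0 t A "dim_col A" k x s] assms by (auto simp: \<tau>_def)
    moreover have "0 < \<tau>"
      unfolding \<tau>_def using assms by (intro divide_pos_pos zero_less_power add_pos_nonneg) auto
    ultimately show ?thesis by simp
  qed
  then show ?thesis by (simp add: l2_step_alt while_option_def)
qed

text \<open>\<open>\<gamma> \<le> 1 / 8\<close> lets the contraction apply, and
  \<open>1 / 32 \<le> \<gamma>\<close> puts its outcome back inside the radius.\<close>

lemma near_central_funpow:
  assumes A: "A \<in> carrier_mat d n" and n: "0 < n" and indep: "indep_rows A"
    and near: "near_central A b c \<gamma> t x s" and \<gamma>: "1 / 32 \<le> \<gamma>" "\<gamma> \<le> 1 / 8"
    and e: "0 < e" "e \<le> t"
  shows "case (l2_body A e ^^ k) (x, s, t, 0) of (x', s', t', _) \<Rightarrow> e \<le> t' \<and> near_central A b c \<gamma> t' x' s'"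
proof (induction k)
  case 0
  then show ?case using near e by simp
next
  case (Suc k)
  obtain x1 s1 t1 k1 where st: "(l2_body A e ^^ k) (x, s, t, 0) = (x1, s1, t1, k1)"
    by (cases "(l2_body A e ^^ k) (x, s, t, 0)")
  define h where "h = 1 / (16 * sqrt (real n))"
  define t' where "t' = max (t1 / (1 + h)) e"
  obtain x2 s2 where step: "newton_step A t' x1 s1 = (x2, s2)" by fastforce
  have t1: "e \<le> t1" "near_central A b c \<gamma> t1 x1 s1" using Suc st by auto
  have "0 < h" using n by (simp add: h_def)
  then have "t1 / (1 + h) \<le> t1" using e t1 by (simp add: field_simps)
  then have t': "t1 / (1 + h) \<le> t'" "t' \<le> t1" "e \<le> t'" using t1 by (auto simp: t'_def)
  have "near_central A b c (1 / 8) t1 x1 s1"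
    using near_central_mono[OF t1(2)] \<gamma> e t1 by auto
  from near_central_newton_step[OF A n indep this _ t'(1,2)[unfolded h_def] step]
  have "near_central A b c \<gamma> t' x2 s2"
    using near_central_mono[of A b c "1 / 32" t'] \<gamma> e t' t1 by auto
  moreover have "l2_body A e (x1, s1, t1, k1) = (x2, s2, t', Suc k1)"
    using A step by (simp add: l2_body_def t'_def h_def Let_def)
  then have "(l2_body A e ^^ Suc k) (x, s, t, 0) = (x2, s2, t', Suc k1)" by (simp add: st)
  ultimately show ?case using t' by simp
qed

text \<open>Because ln (1 + h) >= h/2, the target is reached after (2/h) ln (t/e) rounds, and 2/h =
  32 sqrt n; the summand 1 pays for rounding up.\<close>

lemma l2_step_spec:
  assumes A: "A \<in> carrier_mat d n" and n: "0 < n" and indep: "indep_rows A"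
    and near: "near_central A b c \<gamma> t x s" and \<gamma>: "1 / 32 \<le> \<gamma>" "\<gamma> \<le> 1 / 8"
    and e: "0 < e" "e \<le> t"
  obtains x' s' k where "l2_step A x s t e = Some (x', s', k)"
    and "near_central A b c \<gamma> e x' s'"
    and "real k \<le> 1 + 32 * sqrt (real n) * ln (t / e)"
proof -
  define h where "h = 1 / (16 * sqrt (real n))"
  have dims: "dim_col A = n" using A by auto
  have "1 \<le> sqrt (real n)" using n by simp
  then have h: "0 < h" "h \<le> 1 / 16" by (auto simp: h_def field_simps)
  have ln_h: "h / 2 \<le> ln (1 + h)"
  proof -
    have "h * h \<le> h * (1 / 2)" using h by (intro mult_left_mono) auto
    then have "h / 2 \<le> h - h\<^sup>2" by (simp add: power2_eq_square)
    also have "\<dots> \<le> ln (1 + h)" using h by (intro ln_one_plus_pos_lower_bound) auto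
    finally show ?thesis .
  qed
  let ?cond = "\<lambda>(x :: real vec, s :: real vec, t :: real, k :: nat). t \<noteq> e"
  define st where "st k = (l2_body A e ^^ k) (x, s, t, 0)" for k
  have st: "\<exists>x' s'. st k = (x', s', max (t / (1 + h) ^ k) e, k)" for k
    unfolding st_def h_def using e n by (intro l2_body_funpow dims) auto
  define K where "K = nat \<lceil>ln (t / e) / ln (1 + h)\<rceil>"
  have ln_te: "0 \<le> ln (t / e)" using e by simp
  then have "ln (t / e) / ln (1 + h) \<le> real K" unfolding K_def using h by linarith
  then have "ln (t / e) \<le> real K * ln (1 + h)"
    using h by (simp add: divide_le_eq)
  also have "\<dots> = ln ((1 + h) ^ K)" using h by (simp add: ln_realpow)
  finally have "t / e \<le> (1 + h) ^ K" using e h by (subst (asm) ln_le_cancel_iff) auto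
  then have "t / (1 + h) ^ K \<le> e" using e h by (simp add: field_simps)
  then have stop: "\<not> ?cond (st K)" using st[of K] by auto
  \<comment> \<open>The loop stops at the first index with t = e; \<open>K\<close> only bounds that
    index.\<close>
  define k where "k = (LEAST k. \<not> ?cond (st k))"
  have k: "\<not> ?cond (st k)" "k \<le> K"
    unfolding k_def using stop by (rule LeastI, rule Least_le)
  have ex: "\<exists>k. \<not> ?cond ((l2_body A e ^^ k) (x, s, t, 0))"
    using stop unfolding st_def by (rule exI)
  have "while_option ?cond (l2_body A e) (x, s, t, 0) = Some (st k)"
    unfolding while_option_def if_P[OF ex] k_def st_def ..
  moreover obtain x' s' where st_k: "st k = (x', s', e, k)"
    using st[of k] k by auto
  ultimately have "l2_step A x s t e = Some (x', s', k)" by (simp add: l2_step_alt)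
  moreover have "near_central A b c \<gamma> e x' s'"
    using near_central_funpow[OF A n indep near \<gamma> e, of k] st_k by (simp add: st_def)
  moreover have "real k \<le> 1 + 32 * sqrt (real n) * ln (t / e)"
  proof -
    have "real k \<le> real K" using k by simp
    also have "real K \<le> 1 + ln (t / e) / ln (1 + h)"
      unfolding K_def using ln_te h by (simp add: of_nat_ceiling) linarith
    also have "ln (t / e) / ln (1 + h) \<le> ln (t / e) / (h / 2)"
      using ln_te ln_h h by (intro divide_left_mono) auto
    finally show ?thesis using n by (simp add: h_def mult_ac)
  qed
  ultimately show thesis using that by blast
qed

section \<open>Estimates at the end of the first phase\<close>

text \<open>
  \<open>(xp, xm, xth)\<close> and \<open>(sp, sm, sth)\<close> are the blocks of a primal-dual pair of the modified program,
  \<open>ct\<close> and \<open>bt\<close> its cost \<open>t / x\<^sub>c\<^sup>-\<close> and budget, and \<open>xr\<close> is a point witnessing the inner radius.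
\<close>

lemma modified_central_estimates:
  fixes xp xm sp sm c ct xr :: "nat \<Rightarrow> real"
  assumes n: "0 < n" and q: "q = sqrt (real n)" and r: "0 < r" "r \<le> R" and L: "0 < L"
    and pos: "\<And>i. i < n \<Longrightarrow> 0 < xp i \<and> 0 < xm i \<and> 0 < sp i \<and> 0 < sm i"
    and theta: "0 < xth" "0 < sth"
    and close: "(\<Sum>i<n. (xp i * sp i - L * R)\<^sup>2) + (\<Sum>i<n. (xm i * sm i - L * R)\<^sup>2)
      + (xth * sth - L * R)\<^sup>2 \<le> (L * R / 32)\<^sup>2"
    and budget: "(\<Sum>i<n. xp i) + xth = bt"
    and bt: "495 * (real n + 1) * q * R \<le> bt" "bt \<le> 505 * (real n + 1) * q * R"
    and ct: "\<And>i. i < n \<Longrightarrow> 128000000 * q ^ 6 * (R / r) * L \<le> ct i"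
    and dual_ref: "(\<Sum>i<n. (sp i - sth) * xr i) = (\<Sum>i<n. c i * xr i) - \<kappa>"
    and dual_cur: "(\<Sum>i<n. (sp i - sth) * xp i) + (\<Sum>i<n. sm i * xm i)
      = (\<Sum>i<n. c i * xp i) + (\<Sum>i<n. ct i * xm i) - \<kappa>"
    and xr: "\<And>i. i < n \<Longrightarrow> r \<le> xr i \<and> xr i \<le> R"
    and c: "\<And>i. i < n \<Longrightarrow> \<bar>c i\<bar> \<le> L"
    and outer: "\<And>\<tau> i. 0 \<le> \<tau> \<Longrightarrow> (\<And>j. j < n \<Longrightarrow> 0 \<le> xp j - xm j + \<tau> * xr j) \<Longrightarrow> i < n \<Longrightarrow>
      xp i - xm i + \<tau> * xr i \<le> (1 + \<tau>) * R"
  shows "\<And>i. i < n \<Longrightarrow> xm i < xp i" and "\<And>i. i < n \<Longrightarrow> sth < sp i"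
    and "(\<Sum>i<n. ((xp i - xm i) * (sp i - sth) - L * R)\<^sup>2) \<le> (L * R / 8)\<^sup>2"
proof -
  define T where "T = L * R"
  have R: "0 < R" using r by linarith
  have T: "0 < T" using L R by (simp add: T_def)
  have q1: "1 \<le> q" using n q by simp
  have nq: "real n = q * q" using q by simp
  have n1: "1 \<le> real n" using n by linarith
  have sums0: "0 \<le> (\<Sum>i<n. (xp i * sp i - T)\<^sup>2)" "0 \<le> (\<Sum>i<n. (xm i * sm i - T)\<^sup>2)"
    "0 \<le> (xth * sth - T)\<^sup>2"
    by (auto intro!: sum_nonneg)
  have close': "(\<Sum>i<n. (xp i * sp i - T)\<^sup>2) \<le> (T / 32)\<^sup>2"
    "(\<Sum>i<n. (xm i * sm i - T)\<^sup>2) \<le> (T / 32)\<^sup>2" "(xth * sth - T)\<^sup>2 \<le> (T / 32)\<^sup>2"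
    using close sums0 unfolding T_def[symmetric] by linarith+
  have near: "31 / 32 * T \<le> z \<and> z \<le> 33 / 32 * T" if "(z - T)\<^sup>2 \<le> (T / 32)\<^sup>2" for z
  proof -
    have "\<bar>z - T\<bar> \<le> T / 32"
      using that T by (metis abs_le_square_iff abs_of_pos divide_pos_pos zero_less_numeral)
    then show ?thesis by linarith
  qed
  have prod_p: "31 / 32 * T \<le> xp i * sp i \<and> xp i * sp i \<le> 33 / 32 * T" if "i < n" for i
  proof (rule near)
    have "(xp i * sp i - T)\<^sup>2 \<le> (\<Sum>i<n. (xp i * sp i - T)\<^sup>2)"
      using that by (intro member_le_sum) auto
    then show "(xp i * sp i - T)\<^sup>2 \<le> (T / 32)\<^sup>2" using close' by linarith
  qed
  have prod_m: "31 / 32 * T \<le> xm i * sm i \<and> xm i * sm i \<le> 33 / 32 * T" if "i < n" for i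
  proof (rule near)
    have "(xm i * sm i - T)\<^sup>2 \<le> (\<Sum>i<n. (xm i * sm i - T)\<^sup>2)"
      using that by (intro member_le_sum) auto
    then show "(xm i * sm i - T)\<^sup>2 \<le> (T / 32)\<^sup>2" using close' by linarith
  qed
  have prod_th: "31 / 32 * T \<le> xth * sth \<and> xth * sth \<le> 33 / 32 * T"
    using near close' by blast

  \<comment> \<open>There are 2n + 1 <= 3n products of at most 33/32 T each, and 99/32 <
    31/10.\<close>
  have gap: "(\<Sum>i<n. sp i * xp i) + (\<Sum>i<n. sm i * xm i) + sth * xth \<le> 31 / 10 * (real n * T)"
  proof -
    have "(\<Sum>i<n. sp i * xp i) \<le> real (card {..<n}) * (33 / 32 * T)"
      using prod_p by (intro sum_bounded_above) (simp add: mult.commute)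
    moreover have "(\<Sum>i<n. sm i * xm i) \<le> real (card {..<n}) * (33 / 32 * T)"
      using prod_m by (intro sum_bounded_above) (simp add: mult.commute)
    moreover have "1 * T \<le> real n * T" using n1 T by (intro mult_right_mono) auto
    moreover have "sth * xth \<le> 33 / 32 * T" using prod_th by (simp add: mult.commute)
    moreover have "real (card {..<n}) * (33 / 32 * T) = 33 / 32 * (real n * T)" by simp
    ultimately show ?thesis using T by linarith
  qed
  \<comment> \<open>The duality gap of the current pair against the reference point \<open>(xr, 0, bt - \<Sum> xr)\<close>.\<close>
  have balance: "(\<Sum>i<n. sp i * xr i) + sth * (bt - (\<Sum>i<n. xr i)) + (\<Sum>i<n. ct i * xm i)
    = ((\<Sum>i<n. sp i * xp i) + (\<Sum>i<n. sm i * xm i) + sth * xth)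
      + (\<Sum>i<n. c i * xr i) - (\<Sum>i<n. c i * xp i)"
    using dual_ref dual_cur unfolding budget[symmetric]
    by (simp add: algebra_simps sum_subtractf sum_distrib_left)
  have slack: "0 \<le> sth * (bt - (\<Sum>i<n. xr i))"
  proof -
    have "(\<Sum>i<n. xr i) \<le> (\<Sum>i<n. R)" using xr by (intro sum_mono) auto
    moreover have "1 * R \<le> q * R" using q1 R by (intro mult_right_mono) auto
    then have "real n * R \<le> real n * (q * R)" by (intro mult_left_mono) auto
    moreover have "0 \<le> real n * (q * R)" "0 \<le> q * R" using q1 R by auto
    ultimately have "(\<Sum>i<n. xr i) \<le> bt" using bt(1) by (simp add: algebra_simps)
    then show ?thesis using theta by simp
  qed
  have cost0: "(\<Sum>i<n. c i * xr i) \<le> real n * T"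
  proof -
    have "(\<Sum>i<n. c i * xr i) \<le> (\<Sum>i<n. L * R)"
    proof (intro sum_mono mult_mono)
      fix i assume "i \<in> {..<n}"
      then show "c i \<le> L" "xr i \<le> R" "0 \<le> xr i"
        using c[of i] xr[of i] r by auto
    qed (use L in auto)
    then show ?thesis by (simp add: T_def)
  qed
  have cost_p: "- (\<Sum>i<n. c i * xp i) \<le> L * (\<Sum>i<n. xp i)"
  proof -
    have "- (c i * xp i) \<le> L * xp i" if "i < n" for i
    proof -
      have "(- c i) * xp i \<le> L * xp i"
        using c[OF that] pos[OF that] by (intro mult_right_mono) auto
      then show ?thesis by simp
    qed
    then show ?thesis by (auto simp: sum_negf[symmetric] sum_distrib_left intro!: sum_mono)
  qed
  have term_nonneg: "0 \<le> sp i * xr i" "0 \<le> ct i * xm i" if "i < n" for i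
  proof -
    have "0 \<le> 128000000 * q ^ 6 * (R / r) * L" using q1 R r L by simp
    then have "0 \<le> ct i" using ct[OF that] by linarith
    then show "0 \<le> sp i * xr i" "0 \<le> ct i * xm i" using pos[OF that] xr[OF that] r by auto
  qed
  have sum_nonneg': "0 \<le> (\<Sum>i<n. sp i * xr i)" "0 \<le> (\<Sum>i<n. ct i * xm i)"
    using term_nonneg by (auto intro!: sum_nonneg)

  \<comment> \<open>First reading of \<open>balance\<close>, with the sum of xp bounded only by the
    budget: price q^6 against a right-hand side of order q^3. The surplus q^3 is kept on the left,
    because xp will be bounded below only by a multiple of r/n and has to exceed xm by the factor
    100 q.\<close>
  have xm_le: "xm i * q ^ 3 \<le> r / 100000" if i: "i < n" for i
  proof -
    have "ct i * xm i \<le> (\<Sum>i<n. ct i * xm i)"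
      using i term_nonneg by (intro member_le_sum) auto
    also have "\<dots> \<le> 41 / 10 * (real n * T) + L * bt"
    proof -
      have "L * (\<Sum>i<n. xp i) \<le> L * bt"
        using budget theta L by (intro mult_left_mono) auto
      then show ?thesis using balance gap slack cost0 cost_p sum_nonneg' by linarith
    qed
    also have "\<dots> \<le> 1015 * (L * R * q ^ 3)"
    proof -
      have "(real n * T) * 1 \<le> (real n * T) * q" using T q1 by (intro mult_left_mono) auto
      moreover have "(real n * T) * q = L * R * q ^ 3"
        by (simp add: T_def nq power3_eq_cube mult_ac)
      moreover have "L * bt \<le> L * (505 * (real n + real n) * q * R)"
      proof (intro mult_left_mono)
        have "(505 * q * R) * (real n + 1) \<le> (505 * q * R) * (real n + real n)"
          using n1 q1 R by (intro mult_left_mono) auto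
        then show "bt \<le> 505 * (real n + real n) * q * R" using bt(2) by (simp add: mult_ac)
      qed (use L in auto)
      moreover have "L * (505 * (real n + real n) * q * R) = 1010 * (L * R * q ^ 3)"
        by (simp add: nq power3_eq_cube)
      moreover have "0 \<le> L * R * q ^ 3" using L R q1 by simp
      ultimately show ?thesis by linarith
    qed
    finally have "ct i * xm i \<le> 1015 * (L * R * q ^ 3)" .
    moreover have "(128000000 * q ^ 6 * (R / r) * L) * xm i \<le> ct i * xm i"
      using ct[OF i] pos[OF i] by (intro mult_right_mono) auto
    ultimately have "(L * R * q ^ 3 / r) * (128000000 * (xm i * q ^ 3)) \<le> (L * R * q ^ 3 / r) * (1015 * r)"
      using r by (simp add: mult_ac power_add[symmetric])
    moreover have "0 < L * R * q ^ 3 / r" using L R q1 r by simp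
    ultimately have "128000000 * (xm i * q ^ 3) \<le> 1015 * r"
      by (simp only: mult_le_cancel_left_pos)
    then show ?thesis using r by linarith
  qed
  have q3: "1 \<le> q ^ 3" using q1 by simp
  have xm_le': "xm i \<le> r / 100000" if "i < n" for i
  proof -
    have "xm i * 1 \<le> xm i * q ^ 3" using pos[OF that] q3 by (intro mult_left_mono) auto
    then show ?thesis using xm_le[OF that] by linarith
  qed
  \<comment> \<open>As xm <= r/100000, adding 1/100000 of the inner point makes every coordinate
    nonnegative, and the outer radius becomes applicable.\<close>
  have xp_le: "xp i \<le> 2 * R" if i: "i < n" for i
  proof -
    have "xp i - xm i + 1 / 100000 * xr i \<le> (1 + 1 / 100000) * R"
    proof (rule outer[OF _ _ i])
      fix j assume j: "j < n"
      show "0 \<le> xp j - xm j + 1 / 100000 * xr j"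
        using pos[OF j] xm_le'[OF j] xr[OF j] by linarith
    qed simp
    moreover have "(1 + 1 / 100000) * R = R + R / 100000" by (simp add: field_simps)
    ultimately show ?thesis using xm_le'[OF i] xr[OF i] r by linarith
  qed
  have sum_xp: "(\<Sum>i<n. xp i) \<le> 2 * (real n * R)"
  proof -
    have "(\<Sum>i<n. xp i) \<le> (\<Sum>i<n. 2 * R)" using xp_le by (intro sum_mono) auto
    then show ?thesis by simp
  qed
  \<comment> \<open>Second reading of \<open>balance\<close>, now with the sum of xp at most 2 n R:
    it bounds sp from above, and xp sp being close to T turns this into a lower bound on xp.\<close>
  have xp_ge: "r / 8 \<le> xp i * real n" if i: "i < n" for i
  proof -
    have "sp i * r \<le> sp i * xr i" using xr[OF i] pos[OF i] by (intro mult_left_mono) auto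
    also have "\<dots> \<le> (\<Sum>i<n. sp i * xr i)" using i term_nonneg by (intro member_le_sum) auto
    also have "\<dots> \<le> 7 * (real n * T)"
    proof -
      have "L * (\<Sum>i<n. xp i) \<le> L * (2 * (real n * R))"
        using sum_xp L by (intro mult_left_mono) auto
      also have "\<dots> = 2 * (real n * T)" by (simp add: T_def)
      finally have "L * (\<Sum>i<n. xp i) \<le> 2 * (real n * T)" .
      moreover have "0 \<le> real n * T" using T by simp
      ultimately show ?thesis using balance gap slack cost0 cost_p sum_nonneg' by linarith
    qed
    finally have "xp i * (sp i * r) \<le> xp i * (7 * (real n * T))"
      using pos[OF i] by (intro mult_left_mono) auto
    moreover have "31 / 32 * T * r \<le> xp i * sp i * r"
      using prod_p[OF i] r by (intro mult_right_mono) auto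
    ultimately have "T * (31 / 32 * r) \<le> T * (7 * (xp i * real n))" by (simp add: mult_ac)
    then have "31 / 32 * r \<le> 7 * (xp i * real n)" using T by (simp only: mult_le_cancel_left_pos)
    then show ?thesis using r by linarith
  qed
  have ratio_x: "100 * q * xm i \<le> xp i" if i: "i < n" for i
  proof -
    have "(100 * q * xm i) * real n = 100 * (xm i * q ^ 3)"
      by (simp add: nq power3_eq_cube)
    also have "\<dots> \<le> xp i * real n" using xm_le[OF i] xp_ge[OF i] r by linarith
    finally show ?thesis using n by simp
  qed
  \<comment> \<open>The coordinates of x^+ use up only a small part of the budget, so
    \<open>xth\<close> is at least 495 q R and \<open>sth\<close> at most L/(480 q); on the other
    side xp <= 2 R forces sp >= 31/64 L.\<close>
  have ratio_s: "100 * q * sth \<le> sp i" if i: "i < n" for i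
  proof -
    have "real n * R * 1 \<le> real n * R * q" using q1 R by (intro mult_left_mono) auto
    moreover have "0 \<le> real n * R * q" using q1 R by simp
    ultimately have "495 * (q * R) \<le> xth"
      using budget bt(1) sum_xp by (simp add: algebra_simps)
    then have "495 * (q * R) * sth \<le> xth * sth" using theta by (intro mult_right_mono) auto
    then have "R * (495 * (q * sth)) \<le> R * (33 / 32 * L)"
      using prod_th by (simp add: T_def mult_ac)
    then have 1: "495 * (q * sth) \<le> 33 / 32 * L" using R by (simp only: mult_le_cancel_left_pos)
    have "xp i * sp i \<le> 2 * R * sp i" using xp_le[OF i] pos[OF i] by (intro mult_right_mono) auto
    then have "R * (31 / 32 * L) \<le> R * (2 * sp i)"
      using prod_p[OF i] by (simp add: T_def mult_ac)
    then have "31 / 32 * L \<le> 2 * sp i" using R by (simp only: mult_le_cancel_left_pos)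
    with 1 L show ?thesis by linarith
  qed
  have lt: "z < y" if "100 * q * z \<le> y" "0 < z" for y z
  proof -
    have "1 * z \<le> q * z" using q1 that by (intro mult_right_mono) auto
    then show ?thesis using that by linarith
  qed
  show "xm i < xp i" if "i < n" for i using lt ratio_x[OF that] pos[OF that] by blast
  show "sth < sp i" if "i < n" for i using lt ratio_s[OF that] theta by blast

  \<comment> \<open>The error of passing to differences. Each of its two parts is at most xp sp /
    (100 q), so in the sum over n = q^2 coordinates the dimension cancels.\<close>
  define e where "e i = (xp i - xm i) * (sp i - sth) - xp i * sp i" for i
  have e: "(100 * q)\<^sup>2 * (e i)\<^sup>2 \<le> (33 / 16 * T)\<^sup>2" if i: "i < n" for i
  proof -
    have e_eq: "e i = - (xm i * (sp i - sth) + xp i * sth)" by (simp add: e_def algebra_simps)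
    have "sth < sp i" using lt ratio_s[OF i] theta by blast
    then have "0 \<le> xm i * (sp i - sth)" "0 \<le> xp i * sth" using pos[OF i] theta by auto
    then have nonpos: "e i \<le> 0" unfolding e_eq by linarith
    have "100 * q * (- e i) \<le> (100 * q * xm i) * sp i + xp i * (100 * q * sth)"
      unfolding e_eq using q1 pos[OF i] theta by (simp add: algebra_simps)
    also have "\<dots> \<le> xp i * sp i + xp i * sp i"
      using ratio_x[OF i] ratio_s[OF i] pos[OF i] by (intro add_mono mult_right_mono mult_left_mono) auto
    also have "\<dots> \<le> 33 / 16 * T" using prod_p[OF i] by linarith
    finally have "(100 * q * (- e i))\<^sup>2 \<le> (33 / 16 * T)\<^sup>2"
      using q1 nonpos by (intro power_mono mult_nonneg_nonneg) auto
    then show ?thesis by (simp add: power_mult_distrib)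
  qed
  have "(\<Sum>i<n. (e i)\<^sup>2) \<le> (33 / 1600 * T)\<^sup>2"
  proof -
    have "(100 * q)\<^sup>2 * (\<Sum>i<n. (e i)\<^sup>2) \<le> real n * (33 / 16 * T)\<^sup>2"
      using sum_mono[of "{..<n}" "\<lambda>i. (100 * q)\<^sup>2 * (e i)\<^sup>2" "\<lambda>i. (33 / 16 * T)\<^sup>2"] e
      by (simp add: sum_distrib_left)
    also have "\<dots> = (100 * q)\<^sup>2 * (33 / 1600 * T)\<^sup>2"
      by (simp add: nq power2_eq_square)
    finally show ?thesis using q1 by simp
  qed
  from sum_add_square_le[OF close'(1) this]
  have "(\<Sum>i<n. (xp i * sp i - T + e i)\<^sup>2) \<le> 3 / 2 * (T / 32)\<^sup>2 + 3 * (33 / 1600 * T)\<^sup>2" .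
  also have "\<dots> \<le> (T / 8)\<^sup>2"
    by (simp add: power2_eq_square)
  finally show "(\<Sum>i<n. ((xp i - xm i) * (sp i - sth) - L * R)\<^sup>2) \<le> (L * R / 8)\<^sup>2"
    by (simp add: e_def T_def algebra_simps)
qed

section \<open>Vertices of bounded feasible sets\<close>

lemma lp_feasible_iff:
  assumes "A \<in> carrier_mat d n"
  shows "x \<in> lp_feasible A b \<longleftrightarrow> x \<in> carrier_vec n \<and> A *\<^sub>v x = b \<and> (\<forall>i<n. 0 \<le> x $ i)"
proof -
  have dims: "dim_col A = n" using assms by simp
  have "0\<^sub>v n \<le> x \<longleftrightarrow> (\<forall>i<n. 0 \<le> x $ i)" if "x \<in> carrier_vec n"
    using that by (simp add: less_eq_vec_def)
  then show ?thesis unfolding lp_feasible_def dims mem_Collect_eq by blast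
qed

section \<open>Elementary facts about the Euclidean norm\<close>

lemma l2_norm_sq:
  assumes "x \<in> carrier_vec n"
  shows "(l2_norm x)\<^sup>2 = (\<Sum>i<n. (x $ i)\<^sup>2)"
proof -
  have "x \<bullet> x = (\<Sum>i<n. (x $ i)\<^sup>2)"
    using assms by (simp add: scalar_prod_lessThan power2_eq_square)
  moreover have "0 \<le> (\<Sum>i<n. (x $ i)\<^sup>2)" by (simp add: sum_nonneg)
  ultimately show ?thesis by (simp add: l2_norm_def)
qed

lemma l2_norm_nonneg: "0 \<le> l2_norm x"
  by (auto simp: l2_norm_def scalar_prod_def intro!: sum_nonneg)

lemma l2_norm_L2_set:
  assumes "x \<in> carrier_vec n"
  shows "l2_norm x = L2_set (\<lambda>i. x $ i) {..<n}"
  using assms by (simp add: l2_norm_def scalar_prod_lessThan L2_set_def power2_eq_square)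

lemma abs_index_le_l2_norm:
  assumes "x \<in> carrier_vec n" and "i < n"
  shows "\<bar>x $ i\<bar> \<le> l2_norm x"
proof -
  have "(x $ i)\<^sup>2 \<le> (\<Sum>i<n. (x $ i)\<^sup>2)" using assms by (intro member_le_sum) auto
  then have "\<bar>x $ i\<bar>\<^sup>2 \<le> (l2_norm x)\<^sup>2" using l2_norm_sq[OF assms(1)] by simp
  then show ?thesis using l2_norm_nonneg by (rule power2_le_imp_le)
qed

lemma l2_norm_triangle:
  assumes "x \<in> carrier_vec n" and "y \<in> carrier_vec n"
  shows "l2_norm (x + y) \<le> l2_norm x + l2_norm y"
proof -
  have "l2_norm (x + y) = L2_set (\<lambda>i. x $ i + y $ i) {..<n}"
    unfolding l2_norm_L2_set[OF add_carrier_vec[OF assms]]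
    by (intro L2_set_cong) (use assms in auto)
  also have "\<dots> \<le> l2_norm x + l2_norm y"
    unfolding l2_norm_L2_set[OF assms(1)] l2_norm_L2_set[OF assms(2)] by (rule L2_set_triangle_ineq)
  finally show ?thesis .
qed

lemma l2_norm_smult:
  assumes "x \<in> carrier_vec n" and "0 \<le> a"
  shows "l2_norm (a \<cdot>\<^sub>v x) = a * l2_norm x"
proof -
  have "(a \<cdot>\<^sub>v x) \<bullet> (a \<cdot>\<^sub>v x) = a\<^sup>2 * (x \<bullet> x)" using assms by (simp add: power2_eq_square)
  then show ?thesis using assms by (simp add: l2_norm_def real_sqrt_mult)
qed

lemma l2_norm_minus_le:
  assumes "x \<in> carrier_vec n" and "y \<in> carrier_vec n"
  shows "l2_norm (x - y) \<le> l2_norm x + l2_norm y"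
proof -
  have "x - y = x + (- y)" using assms by (intro eq_vecI) auto
  moreover have "l2_norm (- y) = l2_norm y" using assms by (simp add: l2_norm_def)
  ultimately show ?thesis using l2_norm_triangle[OF assms(1), of "- y"] assms by simp
qed

section \<open>Supports, rays and extreme points\<close>

definition vsupp :: "real vec \<Rightarrow> nat set" where
  "vsupp x = {i. i < dim_vec x \<and> x $ i \<noteq> 0}"

lemma finite_vsupp [simp]: "finite (vsupp x)"
  by (simp add: vsupp_def)

text \<open>The ratio test of the simplex method: follow p until a coordinate vanishes. Some entry
  of p is negative, since otherwise the whole ray would be feasible and would leave the ball of
  radius R. The inclusion of supports makes the step positive and lets no new coordinate enter the
  support.\<close>

lemma ray_leaves_bounded_feasible:
  assumes A: "A \<in> carrier_mat d n" and outer: "outer_radius A b R"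
    and x: "x \<in> lp_feasible A b" and p: "p \<in> carrier_vec n" "A *\<^sub>v p = 0\<^sub>v d" "p \<noteq> 0\<^sub>v n"
    and supp: "vsupp p \<subseteq> vsupp x"
  obtains \<theta> where "0 < \<theta>" and "x + \<theta> \<cdot>\<^sub>v p \<in> lp_feasible A b"
    and "card (vsupp (x + \<theta> \<cdot>\<^sub>v p)) < card (vsupp x)"
proof -
  have xc: "x \<in> carrier_vec n" and Ax: "A *\<^sub>v x = b" and x0: "\<And>i. i < n \<Longrightarrow> 0 \<le> x $ i"
    using x lp_feasible_iff[OF A] by auto
  have A_line: "A *\<^sub>v (x + \<theta> \<cdot>\<^sub>v p) = b" for \<theta>
  proof -
    have "A *\<^sub>v (x + \<theta> \<cdot>\<^sub>v p) = A *\<^sub>v x + \<theta> \<cdot>\<^sub>v (A *\<^sub>v p)"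
      using mult_add_distrib_mat_vec[OF A xc, of "\<theta> \<cdot>\<^sub>v p"] mult_mat_vec[OF A p(1)] p by simp
    then show ?thesis using Ax p A xc by auto
  qed
  define N where "N = {i. i < n \<and> p $ i < 0}"
  have "N \<noteq> {}"
  proof
    assume "N = {}"
    then have p0: "\<And>i. i < n \<Longrightarrow> 0 \<le> p $ i" by (force simp: N_def)
    obtain j where j: "j < n" "p $ j \<noteq> 0"
    proof (rule ccontr)
      assume "\<not> thesis"
      then have "p = 0\<^sub>v n" using that p(1) by (intro eq_vecI) auto
      then show False using p(3) by simp
    qed
    then have pj: "0 < p $ j" using p0[of j] by simp
    \<comment> \<open>Far enough for coordinate j alone to exceed R.\<close>
    define \<theta> where "\<theta> = (\<bar>R\<bar> + 1) / p $ j"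
    have \<theta>: "0 < \<theta>" using pj by (simp add: \<theta>_def)
    have "x + \<theta> \<cdot>\<^sub>v p \<in> lp_feasible A b"
      using A_line xc p x0 p0 \<theta> by (auto simp: lp_feasible_iff[OF A])
    then have "l2_norm (x + \<theta> \<cdot>\<^sub>v p) \<le> R" using outer by (auto simp: outer_radius_def)
    moreover have "\<bar>(x + \<theta> \<cdot>\<^sub>v p) $ j\<bar> \<le> l2_norm (x + \<theta> \<cdot>\<^sub>v p)"
      using xc p j by (intro abs_index_le_l2_norm[of _ n]) auto
    moreover have "(x + \<theta> \<cdot>\<^sub>v p) $ j = x $ j + (\<bar>R\<bar> + 1)"
      using xc p j pj by (simp add: \<theta>_def)
    ultimately show False using x0[OF j(1)] by linarith
  qed
  have finN: "finite N" by (simp add: N_def)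
  define \<theta> where "\<theta> = Min ((\<lambda>i. x $ i / - p $ i) ` N)"
  have \<theta>_le: "\<theta> \<le> x $ i / - p $ i" if "i \<in> N" for i
    unfolding \<theta>_def using finN that by (intro Min_le) auto
  have "\<theta> \<in> (\<lambda>i. x $ i / - p $ i) ` N"
    unfolding \<theta>_def using finN \<open>N \<noteq> {}\<close> by (intro Min_in) auto
  then obtain k where k: "k < n" "p $ k < 0" "\<theta> = x $ k / - p $ k" by (auto simp: N_def)
  have "k \<in> vsupp x" using supp k p by (auto simp: vsupp_def)
  then have "x $ k \<noteq> 0" by (simp add: vsupp_def)
  then have "0 < x $ k" using x0[OF k(1)] by simp
  then have \<theta>: "0 < \<theta>" unfolding k(3) using k(2) by (intro divide_pos_pos) auto
  show thesis
  proof (rule that[OF \<theta>])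
    have "0 \<le> x $ i + \<theta> * p $ i" if i: "i < n" for i
    proof (cases "p $ i < 0")
      case True
      then have "\<theta> \<le> x $ i / - p $ i" using \<theta>_le i by (simp add: N_def)
      then have "\<theta> * - p $ i \<le> x $ i" using True by (subst (asm) pos_le_divide_eq) auto
      then show ?thesis by simp
    qed (use x0[OF i] \<theta> in simp)
    then show "x + \<theta> \<cdot>\<^sub>v p \<in> lp_feasible A b"
      using A_line xc p by (auto simp: lp_feasible_iff[OF A])
    have "vsupp (x + \<theta> \<cdot>\<^sub>v p) \<subseteq> vsupp x"
    proof
      fix i assume "i \<in> vsupp (x + \<theta> \<cdot>\<^sub>v p)"
      then have i: "i < n" "x $ i + \<theta> * p $ i \<noteq> 0" using xc p by (auto simp: vsupp_def)
      then have "x $ i \<noteq> 0 \<or> i \<in> vsupp p" using p by (auto simp: vsupp_def)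
      then show "i \<in> vsupp x" using supp i xc by (auto simp: vsupp_def)
    qed
    moreover have "k \<notin> vsupp (x + \<theta> \<cdot>\<^sub>v p)" using k xc p by (simp add: vsupp_def)
    ultimately have "vsupp (x + \<theta> \<cdot>\<^sub>v p) \<subset> vsupp x" using \<open>k \<in> vsupp x\<close> by blast
    then show "card (vsupp (x + \<theta> \<cdot>\<^sub>v p)) < card (vsupp x)" by (intro psubset_card_mono) auto
  qed
qed

text \<open>
  The induction is on the size of the support: through a feasible point that is not a vertex there is
  a line that leaves the bounded feasible set, in both directions, at points of smaller support.
\<close>

lemma lp_feasible_vertex_induct:
  assumes A: "A \<in> carrier_mat d n" and outer: "outer_radius A b R"
    and x: "x \<in> lp_feasible A b"
    and vertex: "\<And>v. lp_vertex A b v \<Longrightarrow> P v"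
    and convex: "\<And>y z u. y \<in> lp_feasible A b \<Longrightarrow> z \<in> lp_feasible A b \<Longrightarrow> 0 < u \<Longrightarrow> u < 1 \<Longrightarrow>
      P y \<Longrightarrow> P z \<Longrightarrow> P ((1 - u) \<cdot>\<^sub>v y + u \<cdot>\<^sub>v z)"
  shows "P x"
  using x
proof (induction "card (vsupp x)" arbitrary: x rule: less_induct)
  case less
  note x = less.prems
  show ?case
  proof (cases "lp_vertex A b x")
    case False
    then obtain y z u where y: "y \<in> lp_feasible A b" and z: "z \<in> lp_feasible A b" and "y \<noteq> z"
      and u: "0 < u" "u < 1" and xyz: "x = (1 - u) \<cdot>\<^sub>v y + u \<cdot>\<^sub>v z"
      using x by (auto simp: lp_vertex_def)
    note iff = lp_feasible_iff[OF A]
    have yc: "y \<in> carrier_vec n" and zc: "z \<in> carrier_vec n" and xc: "x \<in> carrier_vec n"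
      using x y z by (auto simp: iff)
    define p where "p = z - y"
    have p: "p \<in> carrier_vec n" using yc zc by (simp add: p_def)
    have Ap: "A *\<^sub>v p = 0\<^sub>v d"
      using mult_minus_distrib_mat_vec[OF A zc yc] y z A by (auto simp: iff p_def)
    have p0: "p \<noteq> 0\<^sub>v n"
    proof
      assume "p = 0\<^sub>v n"
      then have "z $ i - y $ i = 0" if "i < n" for i
        using that yc zc by (metis carrier_vecD index_minus_vec(1) index_zero_vec(1) p_def)
      then show False using \<open>y \<noteq> z\<close> yc zc by (auto intro!: eq_vecI)
    qed
    \<comment> \<open>Where y and z differ, one of the two nonnegative entries is positive, and x
      has a positive share of both.\<close>
    have supp: "vsupp p \<subseteq> vsupp x"
    proof
      fix i assume "i \<in> vsupp p"
      then have i: "i < n" "z $ i \<noteq> y $ i" using yc zc by (auto simp: vsupp_def p_def)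
      have yz: "0 \<le> y $ i" "0 \<le> z $ i" using i y z by (auto simp: iff)
      then have "0 < y $ i \<or> 0 < z $ i" using i by linarith
      then have "0 < (1 - u) * y $ i + u * z $ i"
      proof
        assume "0 < y $ i"
        then show ?thesis using u yz by (intro add_pos_nonneg mult_pos_pos mult_nonneg_nonneg) auto
      next
        assume "0 < z $ i"
        then show ?thesis using u yz by (intro add_nonneg_pos mult_pos_pos mult_nonneg_nonneg) auto
      qed
      then show "i \<in> vsupp x" using i yc zc by (simp add: vsupp_def xyz)
    qed
    obtain \<alpha> where \<alpha>: "0 < \<alpha>" "x + \<alpha> \<cdot>\<^sub>v p \<in> lp_feasible A b"
      "card (vsupp (x + \<alpha> \<cdot>\<^sub>v p)) < card (vsupp x)"
      using ray_leaves_bounded_feasible[OF A outer x p Ap p0 supp] by blast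
    have p': "- p \<in> carrier_vec n" "A *\<^sub>v (- p) = 0\<^sub>v d" "- p \<noteq> 0\<^sub>v n"
    proof -
      have "- p = y - z" using yc zc by (intro eq_vecI) (auto simp: p_def)
      then show "A *\<^sub>v (- p) = 0\<^sub>v d"
        using mult_minus_distrib_mat_vec[OF A yc zc] y z A by (auto simp: iff)
      show "- p \<noteq> 0\<^sub>v n" using p0 p by (metis uminus_uminus_vec uminus_zero_vec)
    qed (use p in simp)
    have "vsupp (- p) \<subseteq> vsupp x" using supp p by (auto simp: vsupp_def)
    then obtain \<beta> where \<beta>: "0 < \<beta>" "x + \<beta> \<cdot>\<^sub>v (- p) \<in> lp_feasible A b"
      "card (vsupp (x + \<beta> \<cdot>\<^sub>v (- p))) < card (vsupp x)"
      using ray_leaves_bounded_feasible[OF A outer x p'] by blast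
    \<comment> \<open>The weight at which the displacements \<alpha> p and -\<beta> p
      cancel.\<close>
    define w where "w = \<beta> / (\<alpha> + \<beta>)"
    have w: "0 < w" "w < 1" using \<alpha> \<beta> by (auto simp: w_def)
    have "P ((1 - w) \<cdot>\<^sub>v (x + \<beta> \<cdot>\<^sub>v (- p)) + w \<cdot>\<^sub>v (x + \<alpha> \<cdot>\<^sub>v p))"
      using convex[OF \<beta>(2) \<alpha>(2) w less.hyps[OF \<beta>(3,2)] less.hyps[OF \<alpha>(3,2)]] .
    moreover have "(1 - w) \<cdot>\<^sub>v (x + \<beta> \<cdot>\<^sub>v (- p)) + w \<cdot>\<^sub>v (x + \<alpha> \<cdot>\<^sub>v p) = x"
    proof (rule eq_vecI)
      fix i assume "i < dim_vec x"
      then have i: "i < n" using xc by simp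
      have "w * (\<alpha> + \<beta>) = \<beta>" using \<alpha> \<beta> by (simp add: w_def)
      then have "(1 - w) * \<beta> = w * \<alpha>" by (simp add: algebra_simps)
      moreover have "(1 - w) * (x $ i + \<beta> * - p $ i) + w * (x $ i + \<alpha> * p $ i)
        = x $ i - ((1 - w) * \<beta>) * p $ i + (w * \<alpha>) * p $ i"
        by (simp add: algebra_simps)
      ultimately show "((1 - w) \<cdot>\<^sub>v (x + \<beta> \<cdot>\<^sub>v (- p)) + w \<cdot>\<^sub>v (x + \<alpha> \<cdot>\<^sub>v p)) $ i = x $ i"
        using i xc p by simp
    qed (use xc p in simp)
    ultimately show ?thesis by simp
  qed (rule vertex)
qed

text \<open>If w differed from v, one could go beyond v, away from w, to y = v + \<epsilon> (v - w):
  off the common support nothing changes, and on it a small \<epsilon> keeps y nonnegative. Then v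
  lies strictly between y and w. So a vertex is determined by its support, which makes the vertices
  finite in number.\<close>

lemma vertex_eq_if_vsupp_eq:
  assumes A: "A \<in> carrier_mat d n" and v: "lp_vertex A b v" and w: "w \<in> lp_feasible A b"
    and supp: "vsupp w = vsupp v"
  shows "w = v"
proof (rule ccontr)
  assume "w \<noteq> v"
  note iff = lp_feasible_iff[OF A]
  have vf: "v \<in> lp_feasible A b" using v by (simp add: lp_vertex_def)
  have vc: "v \<in> carrier_vec n" and wc: "w \<in> carrier_vec n" using vf w by (auto simp: iff)
  have v0: "0 \<le> v $ i" and w0: "0 \<le> w $ i" if "i < n" for i using that vf w by (auto simp: iff)
  \<comment> \<open>Chosen so that \<epsilon> (w + 1) <= v on the support. The \<open>+ 1\<close>
    keeps the denominators positive, and the inserted 1 keeps the minimum meaningful for an empty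
    support.\<close>
  define \<epsilon> where "\<epsilon> = Min (insert 1 ((\<lambda>i. v $ i / (w $ i + 1)) ` vsupp v))"
  have "0 < v $ i / (w $ i + 1)" if "i \<in> vsupp v" for i
  proof -
    have "i < n" "v $ i \<noteq> 0" using that vc by (auto simp: vsupp_def)
    then show ?thesis using v0[of i] w0[of i] by (intro divide_pos_pos) auto
  qed
  then have \<epsilon>: "0 < \<epsilon>" unfolding \<epsilon>_def by (subst Min_gr_iff) auto
  define y where "y = (1 + \<epsilon>) \<cdot>\<^sub>v v - \<epsilon> \<cdot>\<^sub>v w"
  have yi: "y $ i = (1 + \<epsilon>) * v $ i - \<epsilon> * w $ i" if "i < n" for i using that vc wc by (simp add: y_def)
  have "0 \<le> y $ i" if i: "i < n" for i
  proof (cases "i \<in> vsupp v")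
    case True
    then have "\<epsilon> \<le> v $ i / (w $ i + 1)" unfolding \<epsilon>_def by (intro Min_le) auto
    then have "\<epsilon> * (w $ i + 1) \<le> v $ i" using w0[OF i] by (simp add: le_divide_eq)
    moreover have "0 \<le> \<epsilon> * v $ i" using \<epsilon> v0[OF i] by simp
    ultimately show ?thesis unfolding yi[OF i] using \<epsilon> by (simp add: algebra_simps)
  next
    case False
    then have "i \<notin> vsupp w" using supp by simp
    then show ?thesis using False i vc wc by (simp add: yi vsupp_def)
  qed
  moreover have "A *\<^sub>v y = b"
  proof -
    have "A *\<^sub>v y = (1 + \<epsilon>) \<cdot>\<^sub>v (A *\<^sub>v v) - \<epsilon> \<cdot>\<^sub>v (A *\<^sub>v w)"
      unfolding y_def using mult_minus_distrib_mat_vec[OF A, of "(1 + \<epsilon>) \<cdot>\<^sub>v v" "\<epsilon> \<cdot>\<^sub>v w"]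
        mult_mat_vec[OF A vc] mult_mat_vec[OF A wc] vc wc by simp
    then show ?thesis using vf w by (auto simp: iff algebra_simps intro!: eq_vecI)
  qed
  ultimately have yf: "y \<in> lp_feasible A b" using vc wc by (simp add: iff y_def)
  define u where "u = \<epsilon> / (1 + \<epsilon>)"
  have u: "0 < u" "u < 1" using \<epsilon> by (auto simp: u_def)
  have "v = (1 - u) \<cdot>\<^sub>v y + u \<cdot>\<^sub>v w"
  proof (rule eq_vecI)
    fix i assume "i < dim_vec ((1 - u) \<cdot>\<^sub>v y + u \<cdot>\<^sub>v w)"
    then have i: "i < n" using wc by simp
    have "(1 - u) * (1 + \<epsilon>) = 1" "(1 - u) * \<epsilon> = u" using \<epsilon> by (auto simp: u_def field_simps)
    then have "(1 - u) * ((1 + \<epsilon>) * v $ i - \<epsilon> * w $ i) + u * w $ i = v $ i"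
      by (simp add: right_diff_distrib mult.assoc[symmetric])
    then show "v $ i = ((1 - u) \<cdot>\<^sub>v y + u \<cdot>\<^sub>v w) $ i"
      using i yi[OF i] vc wc by (simp add: y_def)
  qed (use vc wc in simp)
  moreover have "y \<noteq> w"
  proof
    assume "y = w"
    then have "(1 + \<epsilon>) * v $ i = (1 + \<epsilon>) * w $ i" if "i < n" for i
      using yi[OF that] by (simp add: algebra_simps)
    then have "v $ i = w $ i" if "i < n" for i using \<epsilon> that by simp
    then show False using \<open>w \<noteq> v\<close> vc wc by (auto intro!: eq_vecI)
  qed
  ultimately show False using v yf w u by (auto simp: lp_vertex_def)
qed

lemma finite_lp_vertices:
  assumes A: "A \<in> carrier_mat d n"
  shows "finite {v. lp_vertex A b v}"
proof (rule inj_on_finite)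
  show "inj_on vsupp {v. lp_vertex A b v}"
  proof (rule inj_onI)
    fix v w assume "v \<in> {v. lp_vertex A b v}" "w \<in> {v. lp_vertex A b v}" "vsupp v = vsupp w"
    then show "v = w" using vertex_eq_if_vsupp_eq[OF A, of b w v] by (simp add: lp_vertex_def)
  qed
  show "vsupp ` {v. lp_vertex A b v} \<subseteq> Pow {..<n}"
    using lp_feasible_iff[OF A] by (auto simp: lp_vertex_def vsupp_def)
qed simp

section \<open>Linear costs on the feasible set\<close>

lemma scalar_prod_convex_comb:
  fixes c :: "real vec"
  assumes "c \<in> carrier_vec n" "y \<in> carrier_vec n" "z \<in> carrier_vec n"
  shows "c \<bullet> ((1 - u) \<cdot>\<^sub>v y + u \<cdot>\<^sub>v z) = (1 - u) * (c \<bullet> y) + u * (c \<bullet> z)"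
proof -
  have "c \<bullet> ((1 - u) \<cdot>\<^sub>v y + u \<cdot>\<^sub>v z) = c \<bullet> ((1 - u) \<cdot>\<^sub>v y) + c \<bullet> (u \<cdot>\<^sub>v z)"
    using assms by (intro scalar_prod_add_distrib) auto
  then show ?thesis using assms by simp
qed

text \<open>The cheapest vertex is optimal, since costing at least as much is preserved by convex
  combinations. That there is a vertex at all is the same induction, applied to the predicate that
  is constantly \<open>False\<close>.\<close>

lemma lp_minimizer_exists:
  assumes A: "A \<in> carrier_mat d n" and outer: "outer_radius A b R" and c: "c \<in> carrier_vec n"
    and ne: "x \<in> lp_feasible A b"
  shows "\<exists>v. lp_minimizer A b c v"
proof -
  let ?V = "{v. lp_vertex A b v}"
  have "\<exists>v. lp_vertex A b v"
  proof (rule ccontr)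
    assume "\<nexists>v. lp_vertex A b v"
    then show False using lp_feasible_vertex_induct[OF A outer ne, of "\<lambda>_. False"] by blast
  qed
  then have V: "?V \<noteq> {}" by blast
  define m where "m = Min ((\<lambda>v. c \<bullet> v) ` ?V)"
  have "m \<in> (\<lambda>v. c \<bullet> v) ` ?V"
    unfolding m_def using finite_lp_vertices[OF A] V by (intro Min_in) auto
  then obtain v where v: "lp_vertex A b v" "c \<bullet> v = m" by auto
  have "m \<le> c \<bullet> y" if "y \<in> lp_feasible A b" for y
  proof (rule lp_feasible_vertex_induct[OF A outer that])
    show "m \<le> c \<bullet> w" if "lp_vertex A b w" for w
      unfolding m_def using finite_lp_vertices[OF A] that by (intro Min_le) auto
    fix y z and u :: real
    assume "y \<in> lp_feasible A b" "z \<in> lp_feasible A b" and u: "0 < u" "u < 1"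
      and m: "m \<le> c \<bullet> y" "m \<le> c \<bullet> z"
    then have yz: "y \<in> carrier_vec n" "z \<in> carrier_vec n" by (auto simp: lp_feasible_iff[OF A])
    have "(1 - u) * m + u * m \<le> (1 - u) * (c \<bullet> y) + u * (c \<bullet> z)"
      using u m by (intro add_mono mult_left_mono) auto
    then show "m \<le> c \<bullet> ((1 - u) \<cdot>\<^sub>v y + u \<cdot>\<^sub>v z)"
      unfolding scalar_prod_convex_comb[OF c yz] by (simp add: algebra_simps)
  qed
  then show ?thesis
    using v by (auto simp: lp_minimizer_def is_arg_min_linorder lp_vertex_def)
qed

text \<open>The factor 2 is the diameter: feasible points are at most 2 R apart, while a vertex
  other than z costs at least \<mu> R more than z. The algorithm uses \<mu> = \<eta> L.\<close>

lemma dist_minimizer_le_cost_gap: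
  assumes A: "A \<in> carrier_mat d n" and outer: "outer_radius A b R" and c: "c \<in> carrier_vec n"
    and z: "z \<in> lp_feasible A b" and \<mu>: "0 \<le> \<mu>"
    and gap: "\<And>v. lp_vertex A b v \<Longrightarrow> v \<noteq> z \<Longrightarrow> c \<bullet> z + \<mu> * R \<le> c \<bullet> v"
    and x: "x \<in> lp_feasible A b"
  shows "\<mu> * l2_norm (x - z) \<le> 2 * (c \<bullet> x - c \<bullet> z)"
proof (rule lp_feasible_vertex_induct[OF A outer x])
  have zc: "z \<in> carrier_vec n" using z by (simp add: lp_feasible_iff[OF A])
  show "\<mu> * l2_norm (v - z) \<le> 2 * (c \<bullet> v - c \<bullet> z)" if v: "lp_vertex A b v" for v
  proof (cases "v = z")
    case True
    have "z - z = 0\<^sub>v n" using zc by auto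
    then show ?thesis by (simp add: True l2_norm_def)
  next
    case False
    have vf: "v \<in> lp_feasible A b" using v by (simp add: lp_vertex_def)
    then have vc: "v \<in> carrier_vec n" by (simp add: lp_feasible_iff[OF A])
    have "l2_norm v \<le> R" "l2_norm z \<le> R" using outer vf z by (auto simp: outer_radius_def)
    then have "l2_norm (v - z) \<le> 2 * R" using l2_norm_minus_le[OF vc zc] by linarith
    then have "\<mu> * l2_norm (v - z) \<le> \<mu> * (2 * R)" using \<mu> by (intro mult_left_mono) auto
    then show ?thesis using gap[OF v False] by simp
  qed
  fix y w and u :: real
  assume "y \<in> lp_feasible A b" "w \<in> lp_feasible A b" and u: "0 < u" "u < 1"
    and hyp: "\<mu> * l2_norm (y - z) \<le> 2 * (c \<bullet> y - c \<bullet> z)" "\<mu> * l2_norm (w - z) \<le> 2 * (c \<bullet> w - c \<bullet> z)"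
  then have yw: "y \<in> carrier_vec n" "w \<in> carrier_vec n" by (auto simp: lp_feasible_iff[OF A])
  have "(1 - u) \<cdot>\<^sub>v y + u \<cdot>\<^sub>v w - z = (1 - u) \<cdot>\<^sub>v (y - z) + u \<cdot>\<^sub>v (w - z)"
    using yw zc by (intro eq_vecI) (auto simp: algebra_simps)
  also have "l2_norm \<dots> \<le> (1 - u) * l2_norm (y - z) + u * l2_norm (w - z)"
    using l2_norm_triangle[of "(1 - u) \<cdot>\<^sub>v (y - z)" n "u \<cdot>\<^sub>v (w - z)"] u yw zc
      l2_norm_smult[of "y - z" n "1 - u"] l2_norm_smult[of "w - z" n u] by simp
  finally have "\<mu> * l2_norm ((1 - u) \<cdot>\<^sub>v y + u \<cdot>\<^sub>v w - z)
    \<le> \<mu> * ((1 - u) * l2_norm (y - z) + u * l2_norm (w - z))"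
    using \<mu> by (rule mult_left_mono)
  also have "\<dots> = (1 - u) * (\<mu> * l2_norm (y - z)) + u * (\<mu> * l2_norm (w - z))"
    by (simp add: algebra_simps)
  also have "\<dots> \<le> (1 - u) * (2 * (c \<bullet> y - c \<bullet> z)) + u * (2 * (c \<bullet> w - c \<bullet> z))"
    using u hyp by (intro add_mono mult_left_mono) auto
  also have "\<dots> = 2 * (c \<bullet> ((1 - u) \<cdot>\<^sub>v y + u \<cdot>\<^sub>v w) - c \<bullet> z)"
    unfolding scalar_prod_convex_comb[OF c yw] by (simp add: algebra_simps)
  finally show "\<mu> * l2_norm ((1 - u) \<cdot>\<^sub>v y + u \<cdot>\<^sub>v w - z)
    \<le> 2 * (c \<bullet> ((1 - u) \<cdot>\<^sub>v y + u \<cdot>\<^sub>v w) - c \<bullet> z)" .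
qed

section \<open>The modified constraint matrix\<close>

lemma sum_lessThan_add:
  fixes f :: "nat \<Rightarrow> real"
  shows "(\<Sum>j<n + m. f j) = (\<Sum>j<n. f j) + (\<Sum>j<m. f (n + j))"
  by (induction m) auto

lemma sum_lessThan_blocks:
  fixes f :: "nat \<Rightarrow> real"
  shows "(\<Sum>j<2 * n + 1. f j) = (\<Sum>j<n. f j) + (\<Sum>j<n. f (n + j)) + f (2 * n)"
  using sum_lessThan_add[of f n n] by (simp add: mult_2)

lemma mult_mat_vec_index_sum:
  fixes M :: "real mat"
  assumes "M \<in> carrier_mat d n" and "z \<in> carrier_vec n" and "i < d"
  shows "(M *\<^sub>v z) $ i = (\<Sum>j<n. M $$ (i, j) * z $ j)"
  using assms by (auto simp: scalar_prod_lessThan intro!: sum.cong)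

lemma modified_mat_carrier:
  "A \<in> carrier_mat d n \<Longrightarrow> modified_mat A \<in> carrier_mat (d + 1) (2 * n + 1)"
  by (simp add: modified_mat_def)

definition plus_part :: "nat \<Rightarrow> real vec \<Rightarrow> real vec" where
  "plus_part n z = vec_first z n"

definition minus_part :: "nat \<Rightarrow> real vec \<Rightarrow> real vec" where
  "minus_part n z = vec n (\<lambda>i. z $ (n + i))"

lemma plus_part_carrier [simp]: "plus_part n z \<in> carrier_vec n"
  by (simp add: plus_part_def)

lemma minus_part_carrier [simp]: "minus_part n z \<in> carrier_vec n"
  by (simp add: minus_part_def)

lemma parts_dim [simp]: "dim_vec (plus_part n z) = n" "dim_vec (minus_part n z) = n"
  by (auto simp: plus_part_def minus_part_def)

lemma parts_index [simp]:
  "i < n \<Longrightarrow> plus_part n z $ i = z $ i" "i < n \<Longrightarrow> minus_part n z $ i = z $ (n + i)"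
  by (auto simp: plus_part_def minus_part_def vec_first_def)

lemma const_vec_carrier [simp]: "const_vec n t \<in> carrier_vec n"
  by (simp add: const_vec_def)

lemma modified_mat_mult_vec:
  assumes A: "A \<in> carrier_mat d n" and z: "z \<in> carrier_vec (2 * n + 1)"
  shows "i < d \<Longrightarrow> (modified_mat A *\<^sub>v z) $ i = (A *\<^sub>v (plus_part n z - minus_part n z)) $ i"
    and "(modified_mat A *\<^sub>v z) $ d = (\<Sum>j<n. z $ j) + z $ (2 * n)"
proof -
  note M = modified_mat_carrier[OF A]
  assume i: "i < d"
  have "(modified_mat A *\<^sub>v z) $ i = (\<Sum>j<2 * n + 1. modified_mat A $$ (i, j) * z $ j)"
    using i by (intro mult_mat_vec_index_sum[OF M z]) simp
  also have "\<dots> = (\<Sum>j<n. A $$ (i, j) * z $ j) + (\<Sum>j<n. - A $$ (i, j) * z $ (n + j))"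
    unfolding sum_lessThan_blocks using i A by (simp add: modified_mat_def)
  also have "\<dots> = (\<Sum>j<n. A $$ (i, j) * (plus_part n z - minus_part n z) $ j)"
    unfolding sum.distrib[symmetric] by (intro sum.cong) (auto simp: algebra_simps)
  also have "\<dots> = (A *\<^sub>v (plus_part n z - minus_part n z)) $ i"
    using i by (intro mult_mat_vec_index_sum[OF A, symmetric]) auto
  finally show "(modified_mat A *\<^sub>v z) $ i = (A *\<^sub>v (plus_part n z - minus_part n z)) $ i" .
next
  note M = modified_mat_carrier[OF A]
  have "(modified_mat A *\<^sub>v z) $ d = (\<Sum>j<2 * n + 1. modified_mat A $$ (d, j) * z $ j)"
    by (intro mult_mat_vec_index_sum[OF M z]) simp
  also have "\<dots> = (\<Sum>j<n. z $ j) + z $ (2 * n)"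
    unfolding sum_lessThan_blocks using A by (simp add: modified_mat_def)
  finally show "(modified_mat A *\<^sub>v z) $ d = (\<Sum>j<n. z $ j) + z $ (2 * n)" .
qed

text \<open>In the dual constraints the last block ties the multiplier of the budget row to
  s^\<theta>, and the first block shifts by that multiplier: hence the slack s^+ - s^\<theta> with
  which the second phase starts.\<close>

lemma transpose_modified_mat_mult_vec:
  assumes A: "A \<in> carrier_mat d n" and y: "y \<in> carrier_vec (d + 1)"
  defines "u \<equiv> transpose_mat A *\<^sub>v vec_first y d"
  shows "j < n \<Longrightarrow> (transpose_mat (modified_mat A) *\<^sub>v y) $ j = u $ j + y $ d"
    and "j < n \<Longrightarrow> (transpose_mat (modified_mat A) *\<^sub>v y) $ (n + j) = - u $ j"
    and "(transpose_mat (modified_mat A) *\<^sub>v y) $ (2 * n) = y $ d"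
proof -
  note M = modified_mat_carrier[OF A]
  have idx: "(transpose_mat (modified_mat A) *\<^sub>v y) $ j = (\<Sum>i<d. modified_mat A $$ (i, j) * y $ i) + modified_mat A $$ (d, j) * y $ d"
    if "j < 2 * n + 1" for j
    using mult_mat_vec_index_sum[of "transpose_mat (modified_mat A)" "2 * n + 1" "d + 1" y j] M y that
    by simp
  have u: "u $ j = (\<Sum>i<d. A $$ (i, j) * y $ i)" if "j < n" for j
    using mult_mat_vec_index_sum[of "transpose_mat A" n d "vec_first y d" j] A that
    unfolding u_def by (auto simp: vec_first_def intro!: sum.cong)
  show "(transpose_mat (modified_mat A) *\<^sub>v y) $ j = u $ j + y $ d" if "j < n"
    using A that by (subst idx) (auto simp: u modified_mat_def)
  show "(transpose_mat (modified_mat A) *\<^sub>v y) $ (n + j) = - u $ j" if "j < n"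
    using A that by (subst idx) (auto simp: u modified_mat_def sum_negf)
  show "(transpose_mat (modified_mat A) *\<^sub>v y) $ (2 * n) = y $ d"
    using A by (subst idx) (auto simp: modified_mat_def)
qed

text \<open>The slack column meets only the budget row, so that multiplier vanishes; what the
  columns of x^+ then say is the independence of the rows of A.\<close>

lemma indep_rows_modified_mat:
  assumes A: "A \<in> carrier_mat d n" and indep: "indep_rows A"
  shows "indep_rows (modified_mat A)"
  unfolding indep_rows_def
proof (intro ballI impI)
  note M = modified_mat_carrier[OF A]
  fix y assume "y \<in> carrier_vec (dim_row (modified_mat A))"
    and "transpose_mat (modified_mat A) *\<^sub>v y = 0\<^sub>v (dim_col (modified_mat A))"
  then have y: "y \<in> carrier_vec (d + 1)" and 0: "transpose_mat (modified_mat A) *\<^sub>v y = 0\<^sub>v (2 * n + 1)"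
    using M by auto
  define u where "u = transpose_mat A *\<^sub>v vec_first y d"
  note comp = transpose_modified_mat_mult_vec[OF A y]
  have yd: "y $ d = 0" using comp(3) 0 by simp
  have "u $ j = 0" if "j < n" for j using comp(1)[OF that] 0 yd that by (simp add: u_def)
  then have "u = 0\<^sub>v n" using A by (intro eq_vecI) (auto simp: u_def)
  then have first: "vec_first y d = 0\<^sub>v d" using indep A by (auto simp: indep_rows_def u_def)
  have "y = 0\<^sub>v (d + 1)"
  proof (rule eq_vecI)
    fix i assume "i < dim_vec (0\<^sub>v (d + 1) :: real vec)"
    then have i: "i < d \<or> i = d" by auto
    moreover have "y $ i = 0" if "i < d"
    proof -
      have "y $ i = vec_first y d $ i" using that by (simp add: vec_first_def)
      then show ?thesis using first that by simp
    qed
    ultimately show "y $ i = 0\<^sub>v (d + 1) $ i" using yd by auto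
  qed (use y in simp)
  then show "y = 0\<^sub>v (dim_row (modified_mat A))" using M by simp
qed

section \<open>Duality gap and iteration count\<close>

lemma near_central_prod_le:
  assumes A: "A \<in> carrier_mat d n" and near: "near_central A b c (1 / 8) t x s" and t: "0 < t"
    and i: "i < n"
  shows "x $ i * s $ i \<le> 2 * t"
proof -
  have "(x $ i * s $ i - t)\<^sup>2 \<le> (\<Sum>i<n. (x $ i * s $ i - t)\<^sup>2)"
    using i by (intro member_le_sum) auto
  also have "\<dots> \<le> (1 / 8 * t)\<^sup>2" using near A by (simp add: near_central_def)
  finally have "\<bar>x $ i * s $ i - t\<bar>\<^sup>2 \<le> (1 / 8 * t)\<^sup>2" by simp
  from power2_le_imp_le[OF this] have "\<bar>x $ i * s $ i - t\<bar> \<le> 1 / 8 * t" using t by simp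
  then show ?thesis using t by linarith
qed

text \<open>Weak duality: c z = y b + s z for every solution of A z = b, so the difference in cost
  is at most s x, a sum of n products of at most 2 t.\<close>

lemma near_central_cost:
  assumes A: "A \<in> carrier_mat d n" and near: "near_central A b c (1 / 8) t x s" and t: "0 < t"
    and x': "x' \<in> lp_feasible A b"
  shows "c \<bullet> x \<le> c \<bullet> x' + 2 * real n * t"
proof -
  have dims: "dim_row A = d" "dim_col A = n" using A by auto
  from near have x: "x \<in> carrier_vec n" and s: "s \<in> carrier_vec n" and b: "A *\<^sub>v x = b"
    and pos: "\<And>i. i < n \<Longrightarrow> 0 < s $ i"
    unfolding near_central_def dims by auto
  from near obtain y where y: "y \<in> carrier_vec d" and c: "transpose_mat A *\<^sub>v y + s = c"
    unfolding near_central_def dims by auto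
  have cost: "c \<bullet> z = y \<bullet> b + s \<bullet> z" if "z \<in> carrier_vec n" "A *\<^sub>v z = b" for z
  proof -
    have "c \<bullet> z = (transpose_mat A *\<^sub>v y) \<bullet> z + s \<bullet> z"
      unfolding c[symmetric] using A y s that by (intro add_scalar_prod_distrib) auto
    then show ?thesis using transpose_vec_mult_scalar[OF A that(1) y] that by simp
  qed
  have x'c: "x' \<in> carrier_vec n" "A *\<^sub>v x' = b" "\<And>i. i < n \<Longrightarrow> 0 \<le> x' $ i"
    using x' lp_feasible_iff[OF A] by auto
  have "0 \<le> s \<bullet> x'"
    unfolding scalar_prod_lessThan[OF x'c(1)] using x'c(3) pos
    by (intro sum_nonneg mult_nonneg_nonneg) (auto simp: less_imp_le)
  moreover have "s \<bullet> x \<le> real (card {..<n}) * (2 * t)"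
    unfolding scalar_prod_lessThan[OF x] using near_central_prod_le[OF A near t]
    by (intro sum_bounded_above) (simp add: mult.commute)
  ultimately show ?thesis using cost[OF x b] cost[OF x'c(1,2)] by (simp add: mult_ac)
qed

text \<open>Everything is measured by the argument M of the claimed logarithm. From \<delta> <= 2 n
  follows R/r <= 2 M <= M^2, and q <= R/r puts the powers of the dimension below powers of M as
  well. Since M >= 2 gives ln M >= 1/2, the additive constants are absorbed.\<close>

lemma iteration_count_bound:
  assumes n: "0 < n" and q: "q = sqrt (real n)" and r: "0 < r" "q * r \<le> R"
    and \<delta>: "0 < \<delta>" "\<delta> \<le> 2 * real n"
    and k1: "k1 \<le> 1 + 32 * sqrt (real (2 * n + 1)) * ln (2 ^ 16 * 10 ^ 6 * q ^ 7 * (R / r))"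
    and k2: "k2 \<le> 1 + 32 * q * ln (2 * real n / \<delta>)"
  shows "k1 + k2 \<le> 4000 * q * ln (max 2 (real n * R / (\<delta> * r)))"
proof -
  define \<rho> where "\<rho> = R / r"
  define M where "M = max 2 (real n * R / (\<delta> * r))"
  have q1: "1 \<le> q" using n q by simp
  have \<rho>: "q \<le> \<rho>" using r by (simp add: \<rho>_def field_simps)
  have M2: "2 \<le> M" and M\<rho>: "real n * \<rho> / \<delta> \<le> M" 
    by (auto simp: M_def \<rho>_def mult.commute)
  have le_sq: "2 * M \<le> M\<^sup>2" using M2 by (simp add: power2_eq_square)
  have "\<delta> * \<rho> \<le> (2 * real n) * \<rho>" using \<delta> \<rho> q1 by (intro mult_right_mono) auto
  then have "\<rho> / 2 \<le> real n * \<rho> / \<delta>" using \<delta> by (simp add: field_simps)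
  then have \<rho>_le: "\<rho> \<le> M\<^sup>2" using M\<rho> le_sq by linarith
  \<comment> \<open>10^6 < 2^20, and 36 + 14 + 2 = 52.\<close>
  have "2 ^ 16 * 10 ^ 6 * q ^ 7 * \<rho> \<le> M ^ 36 * (M\<^sup>2) ^ 7 * M\<^sup>2"
  proof (intro mult_mono)
    have "(2::real) ^ 16 * 10 ^ 6 \<le> 2 ^ 36" by simp
    also have "\<dots> \<le> M ^ 36" using M2 by (intro power_mono) auto
    finally show "(2::real) ^ 16 * 10 ^ 6 \<le> M ^ 36" .
    show "q ^ 7 \<le> (M\<^sup>2) ^ 7" using \<rho> \<rho>_le q1 by (intro power_mono) auto
  qed (use \<rho> \<rho>_le q1 M2 in auto)
  also have "\<dots> = M ^ 52" by (simp add: power_mult[symmetric] power_add[symmetric])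
  finally have "ln (2 ^ 16 * 10 ^ 6 * q ^ 7 * \<rho>) \<le> ln (M ^ 52)"
    using q1 \<rho> M2 by (subst ln_le_cancel_iff) auto
  also have "\<dots> = 52 * ln M" using M2 by (simp add: ln_realpow)
  finally have ln1: "ln (2 ^ 16 * 10 ^ 6 * q ^ 7 * \<rho>) \<le> 52 * ln M" .
  have "real n / \<delta> * 1 \<le> real n / \<delta> * \<rho>" using \<delta> q1 \<rho> by (intro mult_left_mono) auto
  then have "2 * real n / \<delta> \<le> M\<^sup>2" using M\<rho> le_sq by simp
  then have "ln (2 * real n / \<delta>) \<le> ln (M\<^sup>2)"
    using n \<delta> M2 by (subst ln_le_cancel_iff) auto
  also have "\<dots> = 2 * ln M" using M2 by (simp add: ln_realpow)
  finally have ln2: "ln (2 * real n / \<delta>) \<le> 2 * ln M" .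
  have "1 \<le> ln ((2::real) ^ 2)" using exp_le by (subst ln_ge_iff) auto
  also have "\<dots> = 2 * ln (2::real)" by (subst ln_realpow) auto
  finally have "1 / 2 \<le> ln (2::real)" by simp
  also have "\<dots> \<le> ln M" using M2 by simp
  finally have lnM: "1 / 2 \<le> ln M" .
  have "sqrt (real (2 * n + 1)) \<le> sqrt (4 * real n)" using n by (intro real_sqrt_le_mono) simp
  also have "\<dots> = 2 * q" unfolding q by (simp add: real_sqrt_mult)
  finally have sq: "sqrt (real (2 * n + 1)) \<le> 2 * q" .
  have "32 * sqrt (real (2 * n + 1)) * ln (2 ^ 16 * 10 ^ 6 * q ^ 7 * \<rho>)
    \<le> 32 * sqrt (real (2 * n + 1)) * (52 * ln M)"
    using ln1 by (intro mult_left_mono) auto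
  also have "\<dots> \<le> 32 * (2 * q) * (52 * ln M)"
    using sq lnM q1 by (intro mult_mono) auto
  finally have "k1 \<le> 1 + 3328 * (q * ln M)" using k1 by (simp add: \<rho>_def)
  moreover have "32 * q * ln (2 * real n / \<delta>) \<le> 32 * q * (2 * ln M)"
    using ln2 q1 by (intro mult_left_mono) auto
  then have "k2 \<le> 1 + 64 * (q * ln M)" using k2 by simp
  moreover have "1 * (1 / 2) \<le> q * ln M" using q1 lnM by (intro mult_mono) auto
  ultimately have "k1 + k2 \<le> 4000 * (q * ln M)" by linarith
  then show ?thesis by (simp add: M_def)
qed

section \<open>The algorithm on a fixed program\<close>

text \<open>Fixing one instance does no harm to the uniformity of the iteration bound, because its
  constant comes out as a numeral.\<close>

locale lp_instance =
  fixes d n :: nat and A :: "real mat" and b c :: "real vec" and r R L :: real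
  assumes A: "A \<in> carrier_mat d n" and b: "b \<in> carrier_vec d" and c: "c \<in> carrier_vec n"
    and n: "0 < n" and rank: "full_row_rank A"
    and r: "0 < r" and inner: "inner_radius A b r" and outer: "outer_radius A b R"
    and L: "0 < L" and norm_c: "l2_norm c \<le> L"
begin

definition q :: real where "q = sqrt (real n)"
definition \<epsilon> :: real where "\<epsilon> = 1 / (100 * q)"
definition Rbar :: real where "Rbar = 5 * R / \<epsilon>"
definition t0 :: real where "t0 = 2 ^ 16 / \<epsilon> ^ 3 * real n ^ 2 * (R / r) * L * R"
definition xp0 :: "real vec" where "xp0 = xc_plus c Rbar t0"
definition xm0 :: "real vec" where "xm0 = xc_minus A b c Rbar t0"
definition xbar :: "real vec" where "xbar = xp0 @\<^sub>v (xm0 @\<^sub>v const_vec 1 Rbar)"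
definition sbar :: "real vec" where "sbar = vec_div (const_vec (2 * n + 1) t0) xbar"

definition x_in :: "real vec" where
  "x_in = (SOME x. x \<in> lp_feasible A b \<and> (\<forall>i<n. r \<le> x $ i))"

lemma indep: "indep_rows A"
  by (rule full_row_rank_imp_indep_rows[OF A rank])

lemma x_in:
  shows x_in_feasible: "x_in \<in> lp_feasible A b" and x_in_ge: "i < n \<Longrightarrow> r \<le> x_in $ i"
proof -
  have "\<exists>x. x \<in> lp_feasible A b \<and> (\<forall>i<n. r \<le> x $ i)"
    using inner A by (auto simp: inner_radius_def)
  then have "x_in \<in> lp_feasible A b \<and> (\<forall>i<n. r \<le> x_in $ i)"
    unfolding x_in_def by (rule someI_ex)
  then show "x_in \<in> lp_feasible A b" "i < n \<Longrightarrow> r \<le> x_in $ i" by auto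
qed

section \<open>Consequences of the two radii and the size of the parameters\<close>

lemma x_in_carrier: "x_in \<in> carrier_vec n" and A_x_in: "A *\<^sub>v x_in = b"
  using x_in_feasible by (simp_all add: lp_feasible_iff[OF A])

lemma feasible_index_le:
  assumes x: "x \<in> lp_feasible A b" and i: "i < n"
  shows "x $ i \<le> R"
proof -
  have "x \<in> carrier_vec n" using x by (simp add: lp_feasible_iff[OF A])
  moreover have "l2_norm x \<le> R" using outer x by (simp add: outer_radius_def)
  ultimately show ?thesis using abs_index_le_l2_norm[of x n i] i by linarith
qed

lemma abs_c_le: "i < n \<Longrightarrow> \<bar>c $ i\<bar> \<le> L"
  using abs_index_le_l2_norm[OF c, of i] norm_c by linarith

lemma q: "1 \<le> q" "q * q = real n"
  using n by (auto simp: q_def)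

lemma r_le_R: "r \<le> R"
  using x_in_ge[OF n] feasible_index_le[OF x_in_feasible n] by linarith

lemma R: "0 < R"
  using r r_le_R by linarith

lemma LR: "0 < L * R"
  using L R by simp

text \<open>The inner point has norm at least sqrt n times r. This is how powers of n in the
  starting parameter are charged to R/r.\<close>

lemma q_r_le_R: "q * r \<le> R"
proof (rule power2_le_imp_le)
  have "(q * r)\<^sup>2 = (\<Sum>i<n. r\<^sup>2)" by (simp add: power_mult_distrib power2_eq_square q)
  also have "\<dots> \<le> (\<Sum>i<n. (x_in $ i)\<^sup>2)"
    using x_in_ge r by (intro sum_mono power_mono) (auto simp: less_imp_le)
  also have "\<dots> = (l2_norm x_in)\<^sup>2" by (simp add: l2_norm_sq[OF x_in_carrier])
  also have "\<dots> \<le> R\<^sup>2"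
    using outer x_in_feasible l2_norm_nonneg by (intro power_mono) (auto simp: outer_radius_def)
  finally show "(q * r)\<^sup>2 \<le> R\<^sup>2" .
qed (use R in simp)

lemma Rbar_eq: "Rbar = 500 * q * R"
  by (simp add: Rbar_def \<epsilon>_def)

lemma Rbar_pos: "0 < Rbar"
  using q R by (simp add: Rbar_eq)

lemma R_le_Rbar: "R \<le> Rbar / 500"
proof -
  have "1 * R \<le> q * R" using q R by (intro mult_right_mono) auto
  then show ?thesis by (simp add: Rbar_eq)
qed

lemma t0_eq: "t0 = 2 ^ 16 * 10 ^ 6 * q ^ 7 * (R / r) * (L * R)"
proof -
  have "t0 = 2 ^ 16 * (100 * q) ^ 3 * (q * q) ^ 2 * (R / r) * L * R"
    unfolding t0_def \<epsilon>_def q(2)[symmetric] power_one_over by simp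
  also have "\<dots> = 2 ^ 16 * 10 ^ 6 * (q ^ 3 * (q * q) ^ 2) * (R / r) * (L * R)"
    by (simp add: power_mult_distrib)
  also have "q ^ 3 * (q * q) ^ 2 = q ^ 7" 
    by (simp add: power_mult_distrib power_add[symmetric])
  finally show ?thesis .
qed

lemma LR_le_t0: "L * R \<le> t0"
proof -
  have "1 \<le> q ^ 7" "1 \<le> R / r" using q r r_le_R by auto
  then have "1 * 1 \<le> q ^ 7 * (R / r)" using q by (intro mult_mono) auto
  then have "1 * (L * R) \<le> (2 ^ 16 * 10 ^ 6 * (q ^ 7 * (R / r))) * (L * R)"
    using LR by (intro mult_right_mono) auto
  then show ?thesis by (simp add: t0_eq mult.assoc)
qed

lemma t0_pos: "0 < t0"
  using LR LR_le_t0 by linarith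

text \<open>\<open>t0 / Rbar\<close> is the price scale of the modified program: up to a few
  percent, every coordinate of x^- costs this much. The numeral is 2^16 * 10^6 / 500.\<close>

lemma t0_div_Rbar: "t0 / Rbar = 131072000 * (q ^ 6 * (R / r) * L)"
proof -
  have "q ^ 7 = q * q ^ 6" by (simp flip: power_Suc)
  then have "t0 = Rbar * (131072000 * (q ^ 6 * (R / r) * L))"
    unfolding t0_eq Rbar_eq by simp
  then show ?thesis using Rbar_pos by simp
qed

text \<open>So c perturbs \<open>t0 / Rbar\<close> by at most a thousandth, which puts every
  starting x^+ coordinate within one percent of \<open>Rbar\<close>.\<close>

lemma L_le: "1000 * L \<le> t0 / Rbar"
proof -
  have "1 \<le> q ^ 6" "1 \<le> R / r" using q r r_le_R by auto
  then have "1 * 1 \<le> q ^ 6 * (R / r)" using q by (intro mult_mono) auto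
  then have "1 * L \<le> q ^ 6 * (R / r) * L" using L by (intro mult_right_mono) auto
  then show ?thesis unfolding t0_div_Rbar using L by linarith
qed

section \<open>The starting point\<close>

lemma xp0_index: "i < n \<Longrightarrow> xp0 $ i = t0 / (c $ i + t0 / Rbar)"
  using c unfolding xp0_def xc_plus_def vec_div_def const_vec_def by simp

lemma xp0_carrier: "xp0 \<in> carrier_vec n"
  using c unfolding xp0_def xc_plus_def vec_div_def const_vec_def by simp

lemma xp0_bounds:
  assumes i: "i < n"
  shows "0 < c $ i + t0 / Rbar" and "99 / 100 * Rbar \<le> xp0 $ i" and "xp0 $ i \<le> 101 / 100 * Rbar"
proof -
  define a where "a = t0 / Rbar"
  have a: "t0 = Rbar * a" "1000 * L \<le> a" using Rbar_pos L_le by (auto simp: a_def)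
  have ca: "0 < c $ i + a" using a abs_c_le[OF i] L by linarith
  then show "0 < c $ i + t0 / Rbar" by (simp add: a_def)
  have "Rbar * (99 / 100 * (c $ i + a)) \<le> Rbar * a"
    using a abs_c_le[OF i] L Rbar_pos by (intro mult_left_mono) auto
  then show "99 / 100 * Rbar \<le> xp0 $ i"
    unfolding xp0_index[OF i] a_def[symmetric] using ca a(1) by (simp add: le_divide_eq algebra_simps)
  have "Rbar * a \<le> Rbar * (101 / 100 * (c $ i + a))"
    using a abs_c_le[OF i] L Rbar_pos by (intro mult_left_mono) auto
  then show "xp0 $ i \<le> 101 / 100 * Rbar"
    unfolding xp0_index[OF i] a_def[symmetric] using ca a(1) by (simp add: divide_le_eq algebra_simps)
qed

text \<open>\<open>xm0\<close> differs from \<open>xp0\<close> only by the vector A^T (A A^T)^-1 b,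
  whose entries are at most R and thus at most \<open>Rbar / 500\<close>; so it stays positive and
  close to \<open>Rbar\<close>.\<close>

lemma xm0_spec:
  shows xm0_carrier: "xm0 \<in> carrier_vec n" and A_diff: "A *\<^sub>v (xp0 - xm0) = b"
    and xm0_bounds: "i < n \<Longrightarrow> 98 / 100 * Rbar \<le> xm0 $ i" "i < n \<Longrightarrow> xm0 $ i \<le> 102 / 100 * Rbar"
proof -
  let ?G = "A * transpose_mat A"
  have G: "?G \<in> carrier_mat d d" and At: "transpose_mat A \<in> carrier_mat n d" using A by auto
  have G_mult: "?G *\<^sub>v v = A *\<^sub>v (transpose_mat A *\<^sub>v v)" if "v \<in> carrier_vec d" for v
    using assoc_mult_mat_vec[OF A At that] .
  have ker: "v = 0\<^sub>v d" if v: "v \<in> carrier_vec d" and 0: "?G *\<^sub>v v = 0\<^sub>v d" for v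
  proof (rule weighted_gram_trivial_kernel[OF A indep _ v, of "\<lambda>_. 1"])
    have "vec n (\<lambda>i. 1 * (transpose_mat A *\<^sub>v v) $ i) = transpose_mat A *\<^sub>v v"
      using A by (intro eq_vecI) auto
    then show "A *\<^sub>v vec n (\<lambda>i. 1 * (transpose_mat A *\<^sub>v v) $ i) = 0\<^sub>v d"
      using 0 G_mult[OF v] by simp
  qed simp
  define w where "w = inv_mat ?G *\<^sub>v b"
  define p where "p = transpose_mat A *\<^sub>v w"
  have w: "w \<in> carrier_vec d"
    unfolding w_def using inv_mat_of_trivial_kernel(1)[OF G ker] b by simp
  have p: "p \<in> carrier_vec n" unfolding p_def using At w by simp
  have "?G *\<^sub>v w = b" unfolding w_def by (rule inv_mat_of_trivial_kernel(2)[OF G ker b])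
  then have Ap: "A *\<^sub>v p = b" using G_mult[OF w] by (simp add: p_def)
  \<comment> \<open>\<open>p\<close> is the least-norm solution of \<open>A x = b\<close>, so its norm is at most \<open>R\<close>.\<close>
  have "p \<bullet> p = p \<bullet> x_in"
    using transpose_vec_mult_scalar[OF A p w] transpose_vec_mult_scalar[OF A x_in_carrier w] Ap A_x_in
    by (simp add: p_def)
  then have pp: "(\<Sum>i<n. p $ i * p $ i) = (\<Sum>i<n. p $ i * x_in $ i)"
    by (simp add: scalar_prod_lessThan[OF p] scalar_prod_lessThan[OF x_in_carrier])
  have "0 \<le> (\<Sum>i<n. (x_in $ i - p $ i)\<^sup>2)" by (intro sum_nonneg) auto
  also have "\<dots> = (\<Sum>i<n. (x_in $ i)\<^sup>2) - 2 * (\<Sum>i<n. p $ i * x_in $ i) + (\<Sum>i<n. p $ i * p $ i)"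
    by (simp add: power2_eq_square algebra_simps sum.distrib sum_subtractf sum_distrib_left)
  also have "(\<Sum>i<n. (x_in $ i)\<^sup>2) = (l2_norm x_in)\<^sup>2" unfolding l2_norm_sq[OF x_in_carrier] ..
  also have "(\<Sum>i<n. p $ i * p $ i) = (l2_norm p)\<^sup>2"
    unfolding l2_norm_sq[OF p] by (simp add: power2_eq_square)
  finally have "(l2_norm p)\<^sup>2 \<le> (l2_norm x_in)\<^sup>2"
    using pp l2_norm_sq[OF p] by (simp add: power2_eq_square)
  then have "l2_norm p \<le> l2_norm x_in" using l2_norm_nonneg by (rule power2_le_imp_le)
  also have "\<dots> \<le> R" using outer x_in_feasible by (auto simp: outer_radius_def)
  finally have p_le: "\<bar>p $ i\<bar> \<le> R" if "i < n" for i using abs_index_le_l2_norm[OF p that] by linarith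
  have xm0: "xm0 = xp0 - p" by (simp add: xm0_def xc_minus_def xp0_def p_def w_def)
  then show "xm0 \<in> carrier_vec n" using xp0_carrier p by simp
  have "xp0 - xm0 = p" unfolding xm0 using xp0_carrier p by (intro eq_vecI) auto
  then show "A *\<^sub>v (xp0 - xm0) = b" using Ap by simp
  show "98 / 100 * Rbar \<le> xm0 $ i" "xm0 $ i \<le> 102 / 100 * Rbar" if "i < n" for i
  proof -
    have "xm0 $ i = xp0 $ i - p $ i" using that xp0_carrier p by (simp add: xm0)
    then show "98 / 100 * Rbar \<le> xm0 $ i" "xm0 $ i \<le> 102 / 100 * Rbar"
      using xp0_bounds[OF that] p_le[OF that] R_le_Rbar Rbar_pos by linarith+
  qed
qed

lemma xbar_carrier: "xbar \<in> carrier_vec (2 * n + 1)"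
proof -
  have "xbar \<in> carrier_vec (n + (n + 1))"
    unfolding xbar_def by (intro append_carrier_vec xp0_carrier xm0_carrier const_vec_carrier)
  then show ?thesis by (simp add: mult_2)
qed

lemma xbar_index:
  "i < n \<Longrightarrow> xbar $ i = xp0 $ i" "i < n \<Longrightarrow> xbar $ (n + i) = xm0 $ i" "xbar $ (2 * n) = Rbar"
  using carrier_vecD[OF xp0_carrier] carrier_vecD[OF xm0_carrier]
  by (simp_all add: xbar_def const_vec_def)

lemma xbar_pos: "i < 2 * n + 1 \<Longrightarrow> 0 < xbar $ i"
proof -
  assume "i < 2 * n + 1"
  then consider "i < n" | j where "j < n" "i = n + j" | "i = 2 * n"
    by (metis add_diff_inverse_nat add_less_cancel_left less_add_one mult_2 not_less_less_Suc_eq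
        Suc_eq_plus1)
  then show ?thesis
  proof cases
    case 1
    then show ?thesis using xp0_bounds(2)[of i] Rbar_pos by (simp add: xbar_index)
  next
    case 2
    then show ?thesis using xm0_bounds(1)[of j] Rbar_pos by (simp add: xbar_index)
  qed (use Rbar_pos xbar_index in simp)
qed

lemma sbar_carrier: "sbar \<in> carrier_vec (2 * n + 1)"
  unfolding sbar_def vec_div_def const_vec_def by simp

lemma sbar_index: "i < 2 * n + 1 \<Longrightarrow> sbar $ i = t0 / xbar $ i"
  by (simp add: sbar_def vec_div_def const_vec_def)

text \<open>
  Right-hand side and cost of the modified program, defined so that the initial pair is feasible by
  construction; the vector \<open>ybar\<close> is its dual certificate.
\<close>

definition bbar :: "real vec" where "bbar = modified_mat A *\<^sub>v xbar"
definition ybar :: "real vec" where "ybar = vec (d + 1) (\<lambda>i. if i < d then 0 else - (t0 / Rbar))"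
definition cbar :: "real vec" where "cbar = transpose_mat (modified_mat A) *\<^sub>v ybar + sbar"

lemma near_central_start: "near_central (modified_mat A) bbar cbar (1 / 32) t0 xbar sbar"
proof -
  note M = modified_mat_carrier[OF A]
  have dims: "dim_col (modified_mat A) = 2 * n + 1" "dim_row (modified_mat A) = d + 1" using M by auto
  have prod: "xbar $ i * sbar $ i = t0" if "i < 2 * n + 1" for i
    using xbar_pos[OF that] by (simp add: sbar_index[OF that])
  have pos: "\<forall>i<2 * n + 1. 0 < xbar $ i \<and> 0 < sbar $ i"
    using xbar_pos t0_pos by (simp add: sbar_index)
  have "(\<Sum>i<2 * n + 1. (xbar $ i * sbar $ i - t0)\<^sup>2) = 0"
    using prod by (intro sum.neutral) auto
  then have close: "(\<Sum>i<2 * n + 1. (xbar $ i * sbar $ i - t0)\<^sup>2) \<le> (1 / 32 * t0)\<^sup>2" by simp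
  have "ybar \<in> carrier_vec (d + 1)" by (simp add: ybar_def)
  then have "\<exists>y \<in> carrier_vec (d + 1). transpose_mat (modified_mat A) *\<^sub>v y + sbar = cbar"
    unfolding cbar_def by blast
  then show ?thesis
    unfolding near_central_def dims using xbar_carrier sbar_carrier pos close bbar_def by metis
qed

lemma bbar_d:
  "495 * (real n + 1) * q * R \<le> bbar $ d" "bbar $ d \<le> 505 * (real n + 1) * q * R"
proof -
  have eq: "bbar $ d = (\<Sum>j<n. xp0 $ j) + Rbar"
  proof -
    have "bbar $ d = (\<Sum>j<n. xbar $ j) + xbar $ (2 * n)"
      unfolding bbar_def by (rule modified_mat_mult_vec(2)[OF A xbar_carrier])
    also have "(\<Sum>j<n. xbar $ j) = (\<Sum>j<n. xp0 $ j)" by (intro sum.cong) (auto simp: xbar_index(1))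
    finally show ?thesis unfolding xbar_index(3) .
  qed
  have "real (card {..<n}) * (99 / 100 * Rbar) \<le> (\<Sum>j<n. xp0 $ j)"
    using xp0_bounds(2) by (intro sum_bounded_below) auto
  moreover have "(\<Sum>j<n. xp0 $ j) \<le> real (card {..<n}) * (101 / 100 * Rbar)"
    using xp0_bounds(3) by (intro sum_bounded_above) auto
  moreover have "0 \<le> q * R" using q R by simp
  ultimately show "495 * (real n + 1) * q * R \<le> bbar $ d" "bbar $ d \<le> 505 * (real n + 1) * q * R"
    unfolding eq Rbar_eq by (auto simp: algebra_simps)
qed

lemma bbar_first: "i < d \<Longrightarrow> bbar $ i = b $ i"
proof -
  assume i: "i < d"
  have "plus_part n xbar - minus_part n xbar = xp0 - xm0"
    using xp0_carrier xm0_carrier by (intro eq_vecI) (auto simp: xbar_index)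
  then show ?thesis
    unfolding bbar_def modified_mat_mult_vec(1)[OF A xbar_carrier i] by (simp add: A_diff)
qed

text \<open>Here \<open>cbar\<close> turns out to be the cost of the modified program. The choice of
  \<open>xp0\<close> makes \<open>t0 / xp0\<close> equal to c + t0 / Rbar, and the last entry of
  \<open>ybar\<close> cancels the second summand there as well as the slack t0 / Rbar of the last
  coordinate.\<close>

lemma cbar_index:
  "i < n \<Longrightarrow> cbar $ i = c $ i" "i < n \<Longrightarrow> cbar $ (n + i) = t0 / xm0 $ i" "cbar $ (2 * n) = 0"
proof -
  have y: "ybar \<in> carrier_vec (d + 1)" by (simp add: ybar_def)
  have first: "vec_first ybar d = 0\<^sub>v d" by (auto simp: vec_first_def ybar_def)
  have u: "(transpose_mat A *\<^sub>v vec_first ybar d) $ i = 0" if "i < n" for i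
    using A that by (simp add: first)
  have yd: "ybar $ d = - (t0 / Rbar)" by (simp add: ybar_def)
  note comp = transpose_modified_mat_mult_vec[OF A y, unfolded yd]
  have idx: "cbar $ j = (transpose_mat (modified_mat A) *\<^sub>v ybar) $ j + t0 / xbar $ j" if "j < 2 * n + 1" for j
    unfolding cbar_def using that sbar_carrier by (simp add: sbar_index)
  show "cbar $ i = c $ i" if i: "i < n"
    using idx[of i] comp(1)[OF i] u[OF i] i xp0_bounds(1)[OF i] t0_pos
    by (simp add: xbar_index xp0_index)
  show "cbar $ (n + i) = t0 / xm0 $ i" if i: "i < n"
    using idx[of "n + i"] comp(2)[OF i] u[OF i] i by (simp add: xbar_index)
  show "cbar $ (2 * n) = 0" using idx[of "2 * n"] comp(3) by (simp add: xbar_index)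
qed

lemma cbar_minus_ge: "i < n \<Longrightarrow> 128000000 * q ^ 6 * (R / r) * L \<le> cbar $ (n + i)"
proof -
  assume i: "i < n"
  define a where "a = q ^ 6 * (R / r) * L"
  have a: "0 \<le> a" using q R r L by (simp add: a_def)
  have t0: "t0 = Rbar * (131072000 * a)"
    using t0_div_Rbar Rbar_pos unfolding a_def by (simp add: divide_eq_eq mult.commute)
  have pos: "0 < xm0 $ i" using xm0_bounds(1)[OF i] Rbar_pos by linarith
  have "128000000 * a * xm0 $ i \<le> 128000000 * a * (102 / 100 * Rbar)"
    using xm0_bounds(2)[OF i] a by (intro mult_left_mono) auto
  also have "\<dots> \<le> t0"
  proof -
    have "0 \<le> Rbar * a" using Rbar_pos a by simp
    then show ?thesis unfolding t0 by (simp add: mult.commute)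
  qed
  finally have "128000000 * a \<le> t0 / xm0 $ i" using pos by (simp add: le_divide_eq)
  then show ?thesis by (simp add: cbar_index(2)[OF i] a_def mult.assoc)
qed

text \<open>The scalar estimates see the dual variable only through \<open>\<kappa>\<close>: the
  product of A^T y' with z is the same number \<open>y' \<bullet> b\<close> for every solution of A
  z = b, be it the inner point or x^+ - x^-.\<close>

lemma near_central_original:
  assumes near: "near_central (modified_mat A) bbar cbar (1 / 32) (L * R) xb sb"
  shows "near_central A b c (1 / 8) (L * R)
    (plus_part n xb - minus_part n xb) (plus_part n sb - const_vec n (sb $ (2 * n)))"
proof -
  note M = modified_mat_carrier[OF A]
  have dims: "dim_col (modified_mat A) = 2 * n + 1" "dim_row (modified_mat A) = d + 1"
    "dim_col A = n" "dim_row A = d" using M A by auto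
  from near have xb: "xb \<in> carrier_vec (2 * n + 1)" and sb: "sb \<in> carrier_vec (2 * n + 1)"
    and Axb: "modified_mat A *\<^sub>v xb = bbar"
    and pos: "\<And>i. i < 2 * n + 1 \<Longrightarrow> 0 < xb $ i \<and> 0 < sb $ i"
    and close: "(\<Sum>i<2 * n + 1. (xb $ i * sb $ i - L * R)\<^sup>2) \<le> (1 / 32 * (L * R))\<^sup>2"
    unfolding near_central_def dims by auto
  from near obtain y where y: "y \<in> carrier_vec (d + 1)"
    and dual: "transpose_mat (modified_mat A) *\<^sub>v y + sb = cbar"
    unfolding near_central_def dims by auto
  define x where "x = plus_part n xb - minus_part n xb"
  define y' where "y' = vec_first y d"
  define u where "u = transpose_mat A *\<^sub>v y'"
  define xp xm sp sm where "xp i = xb $ i" and "xm i = xb $ (n + i)"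
    and "sp i = sb $ i" and "sm i = sb $ (n + i)" for i
  define xth sth where "xth = xb $ (2 * n)" and "sth = sb $ (2 * n)"
  have x: "x \<in> carrier_vec n" by (simp add: x_def)
  have xi: "x $ i = xp i - xm i" if "i < n" for i using that by (simp add: x_def xp_def xm_def)
  have y': "y' \<in> carrier_vec d" by (simp add: y'_def)
  have u: "u \<in> carrier_vec n" using A y' by (simp add: u_def)
  have Ax: "A *\<^sub>v x = b"
  proof (rule eq_vecI)
    fix i assume "i < dim_vec b"
    then have i: "i < d" using b by simp
    have "(A *\<^sub>v x) $ i = (modified_mat A *\<^sub>v xb) $ i"
      using modified_mat_mult_vec(1)[OF A xb i] by (simp add: x_def)
    then show "(A *\<^sub>v x) $ i = b $ i" using Axb bbar_first[OF i] by simp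
  qed (use A b in simp)
  note comp = transpose_modified_mat_mult_vec[OF A y, folded y'_def, folded u_def]
  have dual_idx: "(transpose_mat (modified_mat A) *\<^sub>v y) $ j + sb $ j = cbar $ j" if "j < 2 * n + 1" for j
    using sb that by (simp add: dual[symmetric])
  \<comment> \<open>The slack variable of the budget row has cost 0.\<close>
  have yd: "y $ d = - sth" using dual_idx[of "2 * n"] comp(3) cbar_index(3) by (simp add: sth_def)
  have dual_p: "sp i - sth = c $ i - u $ i" if "i < n" for i
    using dual_idx[of i] comp(1)[OF that] cbar_index(1)[OF that] that yd by (simp add: sp_def)
  have dual_m: "sm i = cbar $ (n + i) + u $ i" if "i < n" for i
    using dual_idx[of "n + i"] comp(2)[OF that] that by (simp add: sm_def)
  have u_prod: "(\<Sum>i<n. u $ i * z $ i) = y' \<bullet> b" if "z \<in> carrier_vec n" "A *\<^sub>v z = b" for z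
    using transpose_vec_mult_scalar[OF A that(1) y'] that(2)
    by (simp add: u_def[symmetric] scalar_prod_lessThan[OF that(1)])
  have dual_ref: "(\<Sum>i<n. (sp i - sth) * x_in $ i) = (\<Sum>i<n. c $ i * x_in $ i) - y' \<bullet> b"
    unfolding u_prod[OF x_in_carrier A_x_in, symmetric] sum_subtractf[symmetric]
    by (intro sum.cong) (auto simp: dual_p left_diff_distrib)
  have dual_cur: "(\<Sum>i<n. (sp i - sth) * xp i) + (\<Sum>i<n. sm i * xm i)
      = (\<Sum>i<n. c $ i * xp i) + (\<Sum>i<n. cbar $ (n + i) * xm i) - y' \<bullet> b"
    unfolding u_prod[OF x Ax, symmetric] sum_subtractf[symmetric] sum.distrib[symmetric]
    by (intro sum.cong) (auto simp: dual_p dual_m xi algebra_simps)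
  \<comment> \<open>x + \<tau> x_in solves the system with right-hand side (1 + \<tau>) b; dividing
    by 1 + \<tau> makes it feasible.\<close>
  have outer': "xp i - xm i + \<tau> * x_in $ i \<le> (1 + \<tau>) * R"
    if \<tau>: "0 \<le> \<tau>" and ge: "\<And>j. j < n \<Longrightarrow> 0 \<le> xp j - xm j + \<tau> * x_in $ j" and i: "i < n" for \<tau> i
  proof -
    define z where "z = (1 / (1 + \<tau>)) \<cdot>\<^sub>v (x + \<tau> \<cdot>\<^sub>v x_in)"
    have z: "z \<in> carrier_vec n" using x x_in_carrier by (simp add: z_def)
    have zi: "z $ j = (xp j - xm j + \<tau> * x_in $ j) / (1 + \<tau>)" if "j < n" for j
      using that x x_in_carrier by (simp add: z_def xi)
    have "A *\<^sub>v z = (1 / (1 + \<tau>)) \<cdot>\<^sub>v (b + \<tau> \<cdot>\<^sub>v b)"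
      unfolding z_def using mult_mat_vec[OF A, of "x + \<tau> \<cdot>\<^sub>v x_in"]
        mult_add_distrib_mat_vec[OF A x, of "\<tau> \<cdot>\<^sub>v x_in"] mult_mat_vec[OF A x_in_carrier]
        x x_in_carrier by (simp add: Ax A_x_in)
    also have "\<dots> = b" using \<tau> by (intro eq_vecI) (auto simp: field_simps)
    finally have "z \<in> lp_feasible A b" using z zi ge \<tau> by (simp add: lp_feasible_iff[OF A])
    then have "z $ i \<le> R" using i by (rule feasible_index_le)
    then show ?thesis using \<tau> by (simp add: zi[OF i] divide_le_eq mult.commute)
  qed
  have budget: "(\<Sum>i<n. xp i) + xth = bbar $ d"
    using modified_mat_mult_vec(2)[OF A xb] Axb by (simp add: xp_def xth_def)
  have close': "(\<Sum>i<n. (xp i * sp i - L * R)\<^sup>2) + (\<Sum>i<n. (xm i * sm i - L * R)\<^sup>2)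
      + (xth * sth - L * R)\<^sup>2 \<le> (L * R / 32)\<^sup>2"
    using close unfolding sum_lessThan_blocks by (simp add: xp_def xm_def sp_def sm_def xth_def sth_def)
  have pos': "\<And>i. i < n \<Longrightarrow> 0 < xp i \<and> 0 < xm i \<and> 0 < sp i \<and> 0 < sm i" "0 < xth" "0 < sth"
    using pos by (auto simp: xp_def xm_def sp_def sm_def xth_def sth_def)
  have x_in_bounds: "\<And>i. i < n \<Longrightarrow> r \<le> x_in $ i \<and> x_in $ i \<le> R"
    using x_in_ge feasible_index_le[OF x_in_feasible] by auto
  have est: "\<And>i. i < n \<Longrightarrow> xm i < xp i" "\<And>i. i < n \<Longrightarrow> sth < sp i"
    "(\<Sum>i<n. ((xp i - xm i) * (sp i - sth) - L * R)\<^sup>2) \<le> (L * R / 8)\<^sup>2"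
    using modified_central_estimates[where xp = xp and xm = xm and sp = sp and sm = sm and xth = xth
        and sth = sth and n = n and q = q and r = r and R = R and L = L and bt = "bbar $ d"
        and ct = "\<lambda>i. cbar $ (n + i)" and xr = "\<lambda>i. x_in $ i" and c = "\<lambda>i. c $ i" and \<kappa> = "y' \<bullet> b"]
      n q_def r r_le_R L pos' close' budget bbar_d cbar_minus_ge dual_ref dual_cur x_in_bounds abs_c_le outer'
    by blast+
  define s where "s = plus_part n sb - const_vec n (sb $ (2 * n))"
  have s: "s \<in> carrier_vec n" by (simp add: s_def)
  have si: "s $ i = sp i - sth" if "i < n" for i
    using that by (simp add: s_def const_vec_def sp_def sth_def)
  have "transpose_mat A *\<^sub>v y' + s = c"
    using u s c dual_p by (intro eq_vecI) (auto simp: u_def[symmetric] si)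
  moreover have "0 < x $ i \<and> 0 < s $ i" if "i < n" for i
    using est(1)[of i] est(2)[of i] that by (simp add: xi si)
  moreover have "(\<Sum>i<n. (x $ i * s $ i - L * R)\<^sup>2) \<le> (1 / 8 * (L * R))\<^sup>2"
    using est(3) by (simp add: xi si)
  ultimately show ?thesis
    unfolding near_central_def dims x_def[symmetric] s_def[symmetric]
    using x s Ax y' by blast
qed

section \<open>The two phases together\<close>

lemma slow_solve_lp_alt:
  "slow_solve_lp A b c r R L \<delta> =
    (case l2_step (modified_mat A) xbar sbar t0 (L * R) of
       None \<Rightarrow> None
     | Some (xb, sb, k1) \<Rightarrow>
         (case l2_step A (plus_part n xb - minus_part n xb)
            (plus_part n sb - const_vec n (sb $ (2 * n))) (L * R) (\<delta> * L * R / (2 * real n)) of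
            None \<Rightarrow> None
          | Some (x_end, s_end, k2) \<Rightarrow> Some (x_end, k1 + k2)))"
proof -
  have dims: "dim_col A = n" using A by simp
  show ?thesis
    unfolding slow_solve_lp_def Let_def dims sbar_def xbar_def xp0_def xm0_def t0_def Rbar_def \<epsilon>_def
      q_def plus_part_def minus_part_def ..
qed

text \<open>\<open>\<delta> \<le> 2 * real n\<close> says that the final parameter is at most L R,
  so that the second phase moves down the path. The radius is 1/32 in the first phase and 1/8 in the
  second.\<close>

lemma slow_solve_lp_spec:
  assumes \<delta>: "0 < \<delta>" "\<delta> \<le> 2 * real n"
  obtains x s k where "slow_solve_lp A b c r R L \<delta> = Some (x, k)"
    and "near_central A b c (1 / 8) (\<delta> * L * R / (2 * real n)) x s"
    and "real k \<le> 4000 * sqrt (real n) * ln (max 2 (real n * R / (\<delta> * r)))"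
proof -
  obtain xb sb k1 where step1: "l2_step (modified_mat A) xbar sbar t0 (L * R) = Some (xb, sb, k1)"
    and near1: "near_central (modified_mat A) bbar cbar (1 / 32) (L * R) xb sb"
    and k1: "real k1 \<le> 1 + 32 * sqrt (real (2 * n + 1)) * ln (t0 / (L * R))"
    using l2_step_spec[OF modified_mat_carrier[OF A] _ indep_rows_modified_mat[OF A indep]
        near_central_start _ _ LR LR_le_t0] by auto
  define e where "e = \<delta> * L * R / (2 * real n)"
  have e: "0 < e" using \<delta> L R n by (simp add: e_def)
  have "\<delta> * (L * R) \<le> (2 * real n) * (L * R)" using \<delta> LR by (intro mult_right_mono) auto
  then have e_le: "e \<le> L * R" using n by (simp add: e_def divide_le_eq mult_ac)
  obtain x s k2 where step2: "l2_step A (plus_part n xb - minus_part n xb)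
      (plus_part n sb - const_vec n (sb $ (2 * n))) (L * R) e = Some (x, s, k2)"
    and near2: "near_central A b c (1 / 8) e x s"
    and k2: "real k2 \<le> 1 + 32 * sqrt (real n) * ln (L * R / e)"
    using l2_step_spec[OF A n indep near_central_original[OF near1] _ _ e e_le] by auto
  have "slow_solve_lp A b c r R L \<delta> = Some (x, k1 + k2)"
    using step1 step2 by (simp add: slow_solve_lp_alt e_def)
  moreover have "real (k1 + k2) \<le> 4000 * sqrt (real n) * ln (max 2 (real n * R / (\<delta> * r)))"
  proof -
    have "t0 / (L * R) = 2 ^ 16 * 10 ^ 6 * q ^ 7 * (R / r)" 
      unfolding t0_eq by (rule nonzero_mult_div_cancel_right) (use L R in simp)
    moreover have "L * R / e = 2 * real n / \<delta>" using L R by (simp add: e_def)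
    ultimately show ?thesis
      using iteration_count_bound[OF n q_def r q_r_le_R \<delta>, of "real k1" "real k2"] k1 k2
      by (simp add: q_def)
  qed
  ultimately show thesis using that near2 unfolding e_def by blast
qed

text \<open>The final parameter is set so that 2 n times it, the gap of a near-central point, equals
  \<delta> L R.\<close>

lemma slow_solve_lp_near_optimal:
  assumes \<delta>: "0 < \<delta>" "\<delta> \<le> 2 * real n"
    and run: "slow_solve_lp A b c r R L \<delta> = Some (x, k)"
  shows "x \<in> lp_feasible A b" and "x' \<in> lp_feasible A b \<Longrightarrow> c \<bullet> x \<le> c \<bullet> x' + \<delta> * L * R"
proof -
  obtain s where near: "near_central A b c (1 / 8) (\<delta> * L * R / (2 * real n)) x s"
    using slow_solve_lp_spec[OF \<delta>] run by (metis fst_conv option.inject)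
  then show "x \<in> lp_feasible A b"
    using A by (auto simp: lp_feasible_iff[OF A] near_central_def less_imp_le)
  have "0 < \<delta> * L * R / (2 * real n)" using \<delta> L R n by simp
  then show "c \<bullet> x \<le> c \<bullet> x' + \<delta> * L * R" if "x' \<in> lp_feasible A b"
    using near_central_cost[OF A near _ that] n by simp
qed

text \<open>The second phase would have to reach parameter 0. Hence at \<delta> = 0 there is no
  output of which the distance bound could speak.\<close>

lemma slow_solve_lp_zero_accuracy: "slow_solve_lp A b c r R L 0 = None"
  using l2_step_zero_target[OF LR, of A] A n by (simp add: slow_solve_lp_alt split: option.split)

lemma slow_solve_lp_dist:
  assumes \<delta>: "0 \<le> \<delta>" "\<delta> \<le> 2 * real n" "\<delta> < \<eta>"
    and run: "slow_solve_lp A b c r R L \<delta> = Some (x, k)"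
    and opt: "lp_minimizer A b c x_opt"
    and gap: "\<And>v. lp_vertex A b v \<Longrightarrow> v \<noteq> x_opt \<Longrightarrow> c \<bullet> x_opt + \<eta> * L * R \<le> c \<bullet> v"
  shows "l2_norm (x - x_opt) \<le> 2 * \<delta> * R / \<eta>"
proof -
  have "\<delta> \<noteq> 0" using run slow_solve_lp_zero_accuracy by auto
  then have \<delta>0: "0 < \<delta>" using \<delta> by simp
  have opt_f: "x_opt \<in> lp_feasible A b"
    using opt by (simp add: lp_minimizer_def is_arg_min_def)
  have "(\<eta> * L) * l2_norm (x - x_opt) \<le> 2 * (c \<bullet> x - c \<bullet> x_opt)"
    using \<delta> L slow_solve_lp_near_optimal(1)[OF \<delta>0 \<delta>(2) run] gap
    by (intro dist_minimizer_le_cost_gap[OF A outer c opt_f]) auto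
  also have "\<dots> \<le> 2 * (\<delta> * L * R)"
    using slow_solve_lp_near_optimal(2)[OF \<delta>0 \<delta>(2) run opt_f] by simp
  finally have "L * (\<eta> * l2_norm (x - x_opt)) \<le> L * (2 * \<delta> * R)" by (simp add: mult_ac)
  then have "\<eta> * l2_norm (x - x_opt) \<le> 2 * \<delta> * R" using L by simp
  then show ?thesis using \<delta> by (simp add: le_divide_eq mult.commute)
qed

end

text \<open>\<open>C\<close> is bound before dimensions and data, which makes the bound on the steps
  uniform; \<open>max 2\<close> keeps the logarithm away from 0.\<close>

theorem theorem2p10:
  shows "\<exists>C::real. \<forall>d n A b c r R L \<delta>.
    A \<in> carrier_mat d n \<and> b \<in> carrier_vec d \<and> c \<in> carrier_vec n \<and> 0 < n \<and>
    full_row_rank A \<and>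
    0 < r \<and> inner_radius A b r \<and> outer_radius A b R \<and> 0 < L \<and> l2_norm c \<le> L \<and>
    \<delta> \<le> 2 * real n \<longrightarrow>
      (0 < \<delta> \<longrightarrow>
        (\<exists>x k. slow_solve_lp A b c r R L \<delta> = Some (x, k) \<and>
          (\<exists>x_opt. lp_minimizer A b c x_opt \<and> c \<bullet> x \<le> c \<bullet> x_opt + \<delta> * L * R) \<and>
          A *\<^sub>v x = b \<and> 0\<^sub>v n \<le> x \<and>
          real k \<le> C * sqrt (real n) * ln (max 2 (real n * R / (\<delta> * r))))) \<and>
      (\<forall>x k x_opt \<eta>.
        0 \<le> \<delta> \<and> \<delta> < \<eta> \<and>
        slow_solve_lp A b c r R L \<delta> = Some (x, k) \<and>
        lp_minimizer A b c x_opt \<and> (\<forall>y. lp_minimizer A b c y \<longrightarrow> y = x_opt) \<and>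
        (\<forall>v. lp_vertex A b v \<and> v \<noteq> x_opt \<longrightarrow> c \<bullet> v \<ge> c \<bullet> x_opt + \<eta> * L * R) \<longrightarrow>
          l2_norm (x - x_opt) \<le> 2 * \<delta> * R / \<eta>)"
proof (intro exI[of _ 4000] allI impI conjI, goal_cases)
  case (1 d n A b c r R L \<delta>)
  then interpret lp_instance d n A b c r R L by unfold_locales auto
  have \<delta>: "0 < \<delta>" "\<delta> \<le> 2 * real n" using 1 by auto
  obtain x s k where run: "slow_solve_lp A b c r R L \<delta> = Some (x, k)"
    and k: "real k \<le> 4000 * sqrt (real n) * ln (max 2 (real n * R / (\<delta> * r)))"
    using slow_solve_lp_spec[OF \<delta>] by blast
  note near_opt = slow_solve_lp_near_optimal[OF \<delta> run]
  obtain x_opt where opt: "lp_minimizer A b c x_opt"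
    using lp_minimizer_exists[OF A outer c x_in_feasible] by blast
  then have "x_opt \<in> lp_feasible A b" by (simp add: lp_minimizer_def is_arg_min_def)
  then have "c \<bullet> x \<le> c \<bullet> x_opt + \<delta> * L * R" by (rule near_opt(2))
  moreover have "A *\<^sub>v x = b" "0\<^sub>v n \<le> x" using near_opt(1) A by (auto simp: lp_feasible_def)
  ultimately show ?case using run k opt by blast
next
  case (2 d n A b c r R L \<delta> x k x_opt \<eta>)
  then interpret lp_instance d n A b c r R L by unfold_locales auto
  show ?case using 2 by (intro slow_solve_lp_dist[of \<delta> \<eta> x k x_opt]) auto
qed

end
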